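(* Let $(W,S)$ be a finite Coxeter system and $k\geq 0$ an integer. For any two Coxeter elements $c,c'$ of $W$ (with any chosen reduced words $\mathbf{c},\mathbf{c}'$), the multi-cluster complexes $\Delta^k_c(W)$ and $\Delta^k_{c'}(W)$ are isomorphic simplicial complexes.
   Context: A Coxeter element is the product of all elements of $S$ in some order; $\mathbf{c}$ denotes a reduced word for $c$. $w_\circ$ is the longest element of $W$. The $c$-sorting word $\mathbf{w}_\circ(\mathbf{c})$ is the lexicographically first (as a sequence of positions) subword of the infinite word $\mathbf{c}\mathbf{c}\mathbf{c}\cdots$ which is a reduced expression for $w_\circ$. For a word $Q=(q_1,\dots,q_r)$ in $S$ and $\pi\in W$, the subword complex $\Delta(Q,\pi)$ is the simplicial complex on the positions $\{1,\dots,r\}$ of $Q$ whose faces are the subsets $P$ such that the word obtained from $Q$ by deleting the positions in $P$ contains a subword which is a reduced expression for $\pi$. The multi-cluster complex is $\Delta^k_c(W)=\Delta(\mathbf{c}^k\,\mathbf{w}_\circ(\mathbf{c}),w_\circ)$, where $\mathbf{c}^k\mathbf{w}_\circ(\mathbf{c})$ is the concatenation of $k$ copies of $\mathbf{c}$ followed by $\mathbf{w}_\circ(\mathbf{c})$. *)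

theory Defs
  imports
    "HOL-Algebra.Generated_Groups"
    "HOL-Algebra.Multiplicative_Group"
    "HOL-Library.Sublist"
begin

definition word_prod :: "('a, 'b) monoid_scheme \<Rightarrow> 'a list \<Rightarrow> 'a" where
  "word_prod W ws = foldr (\<otimes>\<^bsub>W\<^esub>) ws \<one>\<^bsub>W\<^esub>"

text \<open>
  One application of a relation \<open>(s t)\<^bsup>m(s,t)\<^esup> = 1\<close> with \<open>m(s,t)\<close> the order of \<open>s t\<close> in \<open>W\<close>.
  The library's order function is \<open>0\<close> for elements of infinite order, where the step is trivial,
  i.e. there is no relation.  The case \<open>s = t\<close> (order \<open>1\<close>) is the relation \<open>s s = 1\<close>; since it makes
  every generator its own inverse, words without formal inverses suffice to express the group
  presentation.
\<close>

inductive coxeter_step :: "('a, 'b) monoid_scheme \<Rightarrow> 'a set \<Rightarrow> 'a list \<Rightarrow> 'a list \<Rightarrow> bool"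
  for W :: "('a, 'b) monoid_scheme" and S :: "'a set" where
  "\<lbrakk>us \<in> lists S; vs \<in> lists S; s \<in> S; t \<in> S\<rbrakk> \<Longrightarrow>
     coxeter_step W S
       (us @ concat (replicate (group.ord W (s \<otimes>\<^bsub>W\<^esub> t)) [s, t]) @ vs) (us @ vs)"

text \<open>
  Coxeter systems in the sense of Bourbaki: \<open>S\<close> is a generating set of involutions, and
  \<open>\<langle>S | (s t)\<^bsup>m(s,t)\<^esup> = 1\<rangle>\<close> is a presentation of \<open>W\<close>.
\<close>

locale coxeter_system = group W for W :: "('a, 'b) monoid_scheme" (structure) +
  fixes S :: "'a set"
  assumes gens_closed: "S \<subseteq> carrier W"
    and gens_generate: "generate W S = carrier W"
    and gens_order_2: "\<And>s. s \<in> S \<Longrightarrow> ord s = 2"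
    and presentation: "\<And>us vs. \<lbrakk>us \<in> lists S; vs \<in> lists S; word_prod W us = word_prod W vs\<rbrakk>
        \<Longrightarrow> equivclp (coxeter_step W S) us vs"

definition cox_length :: "('a, 'b) monoid_scheme \<Rightarrow> 'a set \<Rightarrow> 'a \<Rightarrow> nat" where
  "cox_length W S w = (LEAST n. \<exists>ws \<in> lists S. word_prod W ws = w \<and> length ws = n)"

definition reduced_expression ::
    "('a, 'b) monoid_scheme \<Rightarrow> 'a set \<Rightarrow> 'a list \<Rightarrow> 'a \<Rightarrow> bool" where
  "reduced_expression W S ws w \<longleftrightarrow>
     ws \<in> lists S \<and> word_prod W ws = w \<and> length ws = cox_length W S w"

definition longest_element :: "('a, 'b) monoid_scheme \<Rightarrow> 'a set \<Rightarrow> 'a" where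
  "longest_element W S =
     (THE w. w \<in> carrier W \<and> (\<forall>v \<in> carrier W. cox_length W S v \<le> cox_length W S w))"

definition coxeter_element :: "('a, 'b) monoid_scheme \<Rightarrow> 'a set \<Rightarrow> 'a \<Rightarrow> bool" where
  "coxeter_element W S c \<longleftrightarrow> (\<exists>ws. distinct ws \<and> set ws = S \<and> c = word_prod W ws)"

definition subword_at :: "'a list \<Rightarrow> nat list \<Rightarrow> 'a list" where
  "subword_at cw ps = map (\<lambda>i. cw ! (i mod length cw)) ps"
  \<comment> \<open>the subword of the infinite periodic word \<open>cw cw cw \<dots>\<close> at the positions \<open>ps\<close>, counted from \<open>0\<close>\<close>

definition reduced_positions ::
    "('a, 'b) monoid_scheme \<Rightarrow> 'a set \<Rightarrow> 'a list \<Rightarrow> 'a \<Rightarrow> nat list \<Rightarrow> bool" where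
  "reduced_positions W S cw w ps \<longleftrightarrow>
     sorted_wrt (<) ps \<and> reduced_expression W S (subword_at cw ps) w"

definition sorting_positions ::
    "('a, 'b) monoid_scheme \<Rightarrow> 'a set \<Rightarrow> 'a list \<Rightarrow> 'a \<Rightarrow> nat list" where
  "sorting_positions W S cw w =
     (THE ps. reduced_positions W S cw w ps \<and>
        (\<forall>qs. reduced_positions W S cw w qs \<longrightarrow> qs = ps \<or> (ps, qs) \<in> lexord less_than))"

definition sorting_word :: "('a, 'b) monoid_scheme \<Rightarrow> 'a set \<Rightarrow> 'a list \<Rightarrow> 'a \<Rightarrow> 'a list" where
  "sorting_word W S cw w = subword_at cw (sorting_positions W S cw w)"

text \<open>
  A simplicial complex is represented by the pair of its ground set and its set of faces.
  Elements of the ground set need not be vertices, i.e. their singletons need not be faces.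
\<close>

type_synonym 'v complex_on = "'v set \<times> 'v set set"

definition subword_complex ::
    "('a, 'b) monoid_scheme \<Rightarrow> 'a set \<Rightarrow> 'a list \<Rightarrow> 'a \<Rightarrow> nat complex_on" where
  "subword_complex W S Q p =
     ({..<length Q},
      {P. P \<subseteq> {..<length Q} \<and>
          (\<exists>ws. subseq ws (nths Q ({..<length Q} - P)) \<and> reduced_expression W S ws p)})"

definition multi_cluster_complex ::
    "('a, 'b) monoid_scheme \<Rightarrow> 'a set \<Rightarrow> nat \<Rightarrow> 'a list \<Rightarrow> nat complex_on" where
  "multi_cluster_complex W S k cw =
     subword_complex W S
       (concat (replicate k cw) @ sorting_word W S cw (longest_element W S))
       (longest_element W S)"

definition complex_isomorphic :: "'v complex_on \<Rightarrow> 'w complex_on \<Rightarrow> bool" where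
  "complex_isomorphic K L \<longleftrightarrow>
     (\<exists>f. bij_betw f (fst K) (fst L) \<and>
          (\<forall>P. P \<subseteq> fst K \<longrightarrow> (P \<in> snd K \<longleftrightarrow> f ` P \<in> snd L)))"

end

theory Submission
  imports Defs
begin

text \<open>
  Write \<open>c\<close> as an enumeration of \<open>S\<close>, i.e. as an acyclic orientation of the Coxeter graph, and
  consider words obtained by repeatedly firing sources, which turns \<open>c = s b\<close> into \<open>b s = s c s\<close>.
  If the word \<open>Q\<close> leads from \<open>c\<close> to \<open>e\<close>, then \<open>c Q = Q e\<close> in \<open>W\<close>.

  A reduced word of maximal length among these represents the longest element.  Otherwise its end
  \<open>e\<close> contains a descent \<open>p\<close> before a non-descent \<open>t\<close> with \<open>p t \<noteq> t p\<close>.  By exchange the word has a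
  suffix \<open>u\<close> starting with a source \<open>r\<close> and with \<open>r u = u p\<close>.  Conjugation by \<open>u\<close> turns \<open>e\<close> into
  a factorization of \<open>r a\<close>, with \<open>a\<close> a product of the generators other than \<open>r\<close>; minimal
  factorizations of \<open>a\<close> into reflections stay in its parabolic subgroup, so \<open>u t u\<inverse>\<close>
  does not involve \<open>r\<close>, and comparing inversions in the group generated by \<open>p\<close> and \<open>t\<close> gives a contradiction.

  The sorting word of the longest element \<open>w\<^sub>0\<close> agrees with such a word up to commutations,
  since the greedy choice only skips letters that the word does not use any more.  Its end is
  \<open>w\<^sub>0 c w\<^sub>0\<close>.  So moving the first letter \<open>s\<close> to the end as \<open>w\<^sub>0 s w\<^sub>0\<close> yields the sorting word
  for \<open>s c s\<close>.  This rotation and commutations induce isomorphisms of subword complexes.  Finally,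
  a finite Coxeter group has a forest as its graph, because a walk without backtracking spells a
  reduced word, and on a forest all orientations are connected by firing sources.
\<close>

section \<open>Words and inversions\<close>

context group
begin

lemma inv_cancel_left [simp]:
  assumes "x \<in> carrier G" "y \<in> carrier G"
  shows "inv x \<otimes> (x \<otimes> y) = y" and "x \<otimes> (inv x \<otimes> y) = y"
  using assms by (simp_all flip: m_assoc)

lemma word_prod_Nil [simp]: "word_prod G [] = \<one>"
  and word_prod_Cons [simp]: "word_prod G (x # xs) = x \<otimes> word_prod G xs"
  by (simp_all add: word_prod_def)

lemma word_prod_closed [simp, intro]: "set xs \<subseteq> carrier G \<Longrightarrow> word_prod G xs \<in> carrier G"
  by (induction xs) auto

lemma word_prod_append [simp]:
  "\<lbrakk>set xs \<subseteq> carrier G; set ys \<subseteq> carrier G\<rbrakk>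
    \<Longrightarrow> word_prod G (xs @ ys) = word_prod G xs \<otimes> word_prod G ys"
  by (induction xs) (auto simp: m_assoc)

end

context coxeter_system
begin

abbreviation wprod :: "'a list \<Rightarrow> 'a" where "wprod \<equiv> word_prod W"
abbreviation len :: "'a \<Rightarrow> nat" where "len \<equiv> cox_length W S"

lemma gen_closed [simp]: "s \<in> S \<Longrightarrow> s \<in> carrier W"
  using gens_closed by blast

lemma gen_word_closed [simp]: "set ws \<subseteq> S \<Longrightarrow> set ws \<subseteq> carrier W"
  using gens_closed by blast

lemma gen_square [simp]: "s \<in> S \<Longrightarrow> s \<otimes> s = \<one>"
proof -
  assume s: "s \<in> S"
  hence "s [^] (2::nat) = \<one>"
    using pow_ord_eq_1[of s] gens_order_2[of s] by simp
  thus ?thesis using s by (simp add: numeral_2_eq_2)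
qed

lemma gen_inv [simp]: "s \<in> S \<Longrightarrow> inv s = s"
  by (rule inv_equality) auto

lemma gen_cancel [simp]: "\<lbrakk>s \<in> S; x \<in> carrier W\<rbrakk> \<Longrightarrow> s \<otimes> (s \<otimes> x) = x"
  by (simp flip: m_assoc)

lemma gen_ne_one: "s \<in> S \<Longrightarrow> s \<noteq> \<one>"
  using gens_order_2[of s] ord_eq_1[of s] by auto

lemma wprod_rev: "set ws \<subseteq> S \<Longrightarrow> wprod (rev ws) = inv (wprod ws)"
  by (induction ws) (auto simp: inv_mult_group)

lemma generate_word:
  assumes "w \<in> generate W J" "J \<subseteq> S"
  obtains ws where "set ws \<subseteq> J" "wprod ws = w"
proof -
  have "\<exists>ws. set ws \<subseteq> J \<and> wprod ws = w"
    using assms(1)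
  proof (induction rule: generate.induct)
    case one
    show ?case by (intro exI[of _ "[]"]) simp
  next
    case (incl h)
    thus ?case using assms(2) by (intro exI[of _ "[h]"]) auto
  next
    case (inv h)
    thus ?case using assms(2) by (intro exI[of _ "[h]"]) auto
  next
    case (eng g h)
    then obtain us vs where *: "set us \<subseteq> J" "wprod us = g" "set vs \<subseteq> J" "wprod vs = h" by blast
    hence "set us \<subseteq> S" "set vs \<subseteq> S" using assms(2) by auto
    thus ?case using * by (intro exI[of _ "us @ vs"]) simp
  qed
  thus ?thesis using that by blast
qed

lemma ex_word:
  assumes "w \<in> carrier W"
  obtains ws where "set ws \<subseteq> S" "wprod ws = w"
  using generate_word[of w S] assms gens_generate by blast

section \<open>Reflection sequences of words and the parity of multiplicities\<close>

text \<open>For letters \<open>q1, q2, ...\<close> these are the reflections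
  \<open>q1 ... q(i-1) qi q(i-1) ... q1\<close>. Multiplying the product of the word by the
  \<open>i\<close>-th one from the left deletes the \<open>i\<close>-th letter.\<close>

fun refl_seq :: "'a list \<Rightarrow> 'a list" where
  "refl_seq [] = []"
| "refl_seq (q # ws) = q # map (\<lambda>x. q \<otimes> x \<otimes> q) (refl_seq ws)"

lemma refl_seq_closed: "set ws \<subseteq> S \<Longrightarrow> set (refl_seq ws) \<subseteq> carrier W"
  by (induction ws) auto

lemma refl_seq_append:
  "\<lbrakk>set us \<subseteq> S; set vs \<subseteq> S\<rbrakk> \<Longrightarrow>
     refl_seq (us @ vs) = refl_seq us @ map (\<lambda>x. wprod us \<otimes> x \<otimes> inv (wprod us)) (refl_seq vs)"
proof (induction us)
  case Nil
  have "map (\<lambda>x. \<one> \<otimes> x \<otimes> inv \<one>) (refl_seq vs) = map id (refl_seq vs)"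
    using refl_seq_closed[OF Nil(2)] by (intro map_cong) (auto simp: subset_iff)
  thus ?case by simp
next
  case (Cons a us)
  thus ?case using refl_seq_closed[OF Cons(3)]
    by (auto simp: m_assoc inv_mult_group subset_iff)
qed

lemma refl_seq_relation:
  assumes "s \<in> S" "t \<in> S"
  shows "refl_seq (concat (replicate j [s, t])) = map (\<lambda>i::nat. (s \<otimes> t) [^] i \<otimes> s) [0..<2 * j]"
proof (induction j)
  case (Suc j)
  have st: "(s \<otimes> t) [^] Suc i = s \<otimes> t \<otimes> (s \<otimes> t) [^] i" for i :: nat
    using assms by (simp add: nat_pow_Suc2[symmetric] del: nat_pow_Suc)
  have *: "s \<otimes> (t \<otimes> ((s \<otimes> t) [^] i \<otimes> s) \<otimes> t) \<otimes> s = (s \<otimes> t) [^] (Suc (Suc i)) \<otimes> s" for i :: nat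
  proof -
    have "s \<otimes> (t \<otimes> ((s \<otimes> t) [^] i \<otimes> s) \<otimes> t) \<otimes> s = (s \<otimes> t \<otimes> (s \<otimes> t) [^] i) \<otimes> (s \<otimes> t) \<otimes> s"
      using assms by (simp add: m_assoc del: nat_pow_Suc)
    also have "\<dots> = (s \<otimes> t) [^] (Suc (Suc i)) \<otimes> s"
      by (simp only: st[symmetric] nat_pow_Suc[symmetric])
    finally show ?thesis .
  qed
  have "[0..<2 * Suc j] = 0 # 1 # map (\<lambda>i. Suc (Suc i)) [0..<2 * j]"
    by (simp add: upt_conv_Cons map_Suc_upt[symmetric] del: upt_Suc)
  moreover have "refl_seq (concat (replicate (Suc j) [s, t]))
      = s # s \<otimes> t \<otimes> s # map (\<lambda>i. (s \<otimes> t) [^] (Suc (Suc i)) \<otimes> s) [0..<2 * j]"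
    using Suc by (simp add: comp_def * del: nat_pow_Suc)
  ultimately show ?case
    using assms by (simp add: comp_def)
qed simp

text \<open>With \<open>m\<close> the order of \<open>s t\<close>, the exponents
  \<open>0, ..., 2 m - 1\<close> run through a full period of the powers of \<open>s t\<close>
  exactly twice. For infinite order the relator is the empty word.\<close>

lemma even_count_relation:
  assumes "s \<in> S" "t \<in> S"
  shows "even (count_list (refl_seq (concat (replicate (ord (s \<otimes> t)) [s, t]))) x)"
proof -
  let ?m = "ord (s \<otimes> t)"
  have "[0..<2 * ?m] = [0..<?m] @ map (\<lambda>i. i + ?m) [0..<?m]"
    using upt_add_eq_append[of 0 ?m ?m] by (simp add: map_add_upt mult_2)
  moreover have "(s \<otimes> t) [^] (i + ?m) = (s \<otimes> t) [^] i" for i :: nat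
    using assms by (simp flip: nat_pow_mult)
  ultimately have "refl_seq (concat (replicate ?m [s, t])) =
      map (\<lambda>i::nat. (s \<otimes> t) [^] i \<otimes> s) [0..<?m] @ map (\<lambda>i::nat. (s \<otimes> t) [^] i \<otimes> s) [0..<?m]"
    by (simp add: refl_seq_relation[OF assms] comp_def)
  thus ?thesis by simp
qed

lemma count_list_map_conj:
  assumes "set xs \<subseteq> carrier W" "g \<in> carrier W" "x \<in> carrier W"
  shows "count_list (map (\<lambda>y. g \<otimes> y \<otimes> inv g) xs) x = count_list xs (inv g \<otimes> x \<otimes> g)"
  using assms(1)
proof (induction xs)
  case (Cons a xs)
  have "g \<otimes> a \<otimes> inv g = x \<longleftrightarrow> a = inv g \<otimes> x \<otimes> g"
    using Cons(2) assms(2,3) by (auto simp: m_assoc)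
  thus ?case using Cons by auto
qed simp

lemma count_refl_seq_append:
  assumes "set us \<subseteq> S" "set vs \<subseteq> S" "x \<in> carrier W"
  shows "count_list (refl_seq (us @ vs)) x
    = count_list (refl_seq us) x + count_list (refl_seq vs) (inv (wprod us) \<otimes> x \<otimes> wprod us)"
  using assms by (simp add: refl_seq_append count_list_map_conj refl_seq_closed)

lemma wprod_relation: 
  assumes "s \<in> S" "t \<in> S"
  shows "wprod (concat (replicate (ord (s \<otimes> t)) [s, t])) = \<one>"
proof -
  have "wprod (concat (replicate j [s, t])) = (s \<otimes> t) [^] j" for j :: nat
  proof (induction j)
    case (Suc j)
    have "s \<otimes> t \<otimes> (s \<otimes> t) [^] j = (s \<otimes> t) [^] Suc j"
      using assms by (simp only: nat_pow_Suc2 m_closed gen_closed)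
    thus ?case using assms Suc by (simp add: m_assoc)
  qed simp
  thus ?thesis using assms by simp
qed

text \<open>The relator contributes evenly itself, and its product is trivial, so the reflections of
  the letters behind it are conjugated as before.\<close>

lemma coxeter_step_parity:
  assumes "coxeter_step W S us vs" "x \<in> carrier W"
  shows "odd (count_list (refl_seq us) x) \<longleftrightarrow> odd (count_list (refl_seq vs) x)"
  using assms(1)
proof cases
  case (1 as bs s t)
  let ?R = "concat (replicate (ord (s \<otimes> t)) [s, t])"
  have R: "set ?R \<subseteq> S" using 1 by (auto simp: set_replicate_conv_if split: if_splits)
  have ab: "set as \<subseteq> S" "set bs \<subseteq> S" using 1 by auto
  show ?thesis
    using ab R assms(2) 1 even_count_relation[OF 1(5,6)] wprod_relation[OF 1(5,6)]
    by (simp add: count_refl_seq_append)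
qed

text \<open>The presentation of \<open>W\<close> enters here: parity is invariant under the defining
  relations and hence depends only on the group element. This takes the place of the sign action on
  roots.\<close>

lemma refl_parity_well_defined:
  assumes "set us \<subseteq> S" "set vs \<subseteq> S" "wprod us = wprod vs" "x \<in> carrier W"
  shows "odd (count_list (refl_seq us) x) \<longleftrightarrow> odd (count_list (refl_seq vs) x)"
proof -
  have "equivclp (coxeter_step W S) us vs"
    using presentation[of us vs] assms by (auto simp: in_lists_conv_set)
  thus ?thesis
    by (induction rule: equivclp_induct) (use coxeter_step_parity assms(4) in blast)+
qed

section \<open>Inversions, reflections and strong exchange\<close>

text \<open>Left inversions by parity: one witnessing word is as good as all words. For reflections
  \<open>x\<close> this becomes \<open>len (x w) < len w\<close> in
  \<open>inversion_iff\<close>.\<close>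

definition inversion :: "'a \<Rightarrow> 'a \<Rightarrow> bool" where
  "inversion w x \<longleftrightarrow> (\<exists>ws. set ws \<subseteq> S \<and> wprod ws = w \<and> odd (count_list (refl_seq ws) x))"

lemma inversion_wprod:
  "\<lbrakk>set ws \<subseteq> S; x \<in> carrier W\<rbrakk> \<Longrightarrow> inversion (wprod ws) x \<longleftrightarrow> odd (count_list (refl_seq ws) x)"
  unfolding inversion_def using refl_parity_well_defined by blast

text \<open>The cocycle rule \<open>N(v w) = N(v) + v N(w) v^-1\<close> for inversion sets, with
  symmetric difference as addition.\<close>

lemma inversion_mult:
  assumes "v \<in> carrier W" "w \<in> carrier W" "x \<in> carrier W"
  shows "inversion (v \<otimes> w) x \<longleftrightarrow> inversion v x \<noteq> inversion w (inv v \<otimes> x \<otimes> v)"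
proof -
  obtain us vs where "set us \<subseteq> S" "wprod us = v" "set vs \<subseteq> S" "wprod vs = w"
    using ex_word assms by metis
  thus ?thesis
    using inversion_wprod[of "us @ vs" x] inversion_wprod[of us x] inversion_wprod[of vs] assms
    by (auto simp: count_refl_seq_append)
qed

lemma inversion_gen: "\<lbrakk>s \<in> S; x \<in> carrier W\<rbrakk> \<Longrightarrow> inversion s x \<longleftrightarrow> x = s"
  using inversion_wprod[of "[s]" x] by auto

lemma inversion_one: "x \<in> carrier W \<Longrightarrow> \<not> inversion \<one> x"
  using inversion_wprod[of "[]" x] by auto

definition reflections :: "'a set" where
  "reflections = {g \<otimes> s \<otimes> inv g | g s. g \<in> carrier W \<and> s \<in> S}"

lemma reflectionsI: "\<lbrakk>g \<in> carrier W; s \<in> S\<rbrakk> \<Longrightarrow> g \<otimes> s \<otimes> inv g \<in> reflections"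
  unfolding reflections_def by blast

lemma reflectionsE:
  assumes "x \<in> reflections"
  obtains g s where "g \<in> carrier W" "s \<in> S" "x = g \<otimes> s \<otimes> inv g"
  using assms unfolding reflections_def by blast

lemma gen_reflection [simp]: "s \<in> S \<Longrightarrow> s \<in> reflections"
  using reflectionsI[of \<one> s] by simp

lemma reflection_closed [simp]: "x \<in> reflections \<Longrightarrow> x \<in> carrier W"
  unfolding reflections_def by auto

lemma reflection_square [simp]: "x \<in> reflections \<Longrightarrow> x \<otimes> x = \<one>"
  unfolding reflections_def by (auto simp: m_assoc)

lemma reflection_cancel [simp]:
  "\<lbrakk>x \<in> reflections; y \<in> carrier W\<rbrakk> \<Longrightarrow> x \<otimes> (x \<otimes> y) = y"
  by (simp flip: m_assoc)

lemma reflection_inv [simp]: "x \<in> reflections \<Longrightarrow> inv x = x"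
  by (rule inv_equality) auto

lemma reflection_conj:
  assumes "x \<in> reflections" "g \<in> carrier W"
  shows "g \<otimes> x \<otimes> inv g \<in> reflections"
proof -
  obtain h s where "h \<in> carrier W" "s \<in> S" "x = h \<otimes> s \<otimes> inv h"
    using assms reflectionsE by blast
  moreover from this have "g \<otimes> x \<otimes> inv g = (g \<otimes> h) \<otimes> s \<otimes> inv (g \<otimes> h)"
    using assms by (simp add: m_assoc inv_mult_group)
  ultimately show ?thesis using reflectionsI[of "g \<otimes> h" s] assms by simp
qed

text \<open>For \<open>x = g s g^-1\<close> the contributions of \<open>g\<close> and
  \<open>g^-1\<close> cancel, because \<open>g g^-1\<close> has no inversions. What remains is the
  contribution of \<open>s\<close>, which is odd.\<close>

lemma inversion_reflection: 
  assumes "x \<in> reflections"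
  shows "inversion x x"
proof -
  obtain g s where g: "g \<in> carrier W" "s \<in> S" "x = g \<otimes> s \<otimes> inv g"
    using assms reflectionsE by blast
  have c: "inv g \<otimes> x \<otimes> g = s" using g by (simp add: m_assoc)
  have "\<not> inversion (g \<otimes> inv g) x" using g assms inversion_one by simp
  hence 1: "inversion g x \<longleftrightarrow> inversion (inv g) s"
    using g assms c inversion_mult[of g "inv g" x] by simp
  have "inversion (g \<otimes> s) x \<longleftrightarrow> \<not> inversion g x"
    using g assms c inversion_mult[of g s x] inversion_gen by auto
  moreover have "inv (g \<otimes> s) \<otimes> x \<otimes> (g \<otimes> s) = s"
    using g by (simp add: m_assoc inv_mult_group)
  ultimately show ?thesis
    using g assms 1 inversion_mult[of "g \<otimes> s" "inv g" x] by simp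
qed

lemma refl_seq_deletion:
  assumes "set ws \<subseteq> S" "x \<in> set (refl_seq ws)"
  shows "\<exists>as s bs. ws = as @ s # bs \<and> x = wprod as \<otimes> s \<otimes> inv (wprod as)"
  using assms
proof (induction ws arbitrary: x)
  case (Cons q ws)
  show ?case
  proof (cases "x = q")
    case True
    thus ?thesis using Cons(2) by (intro exI[of _ "[]"]) auto
  next
    case False
    then obtain y where y: "y \<in> set (refl_seq ws)" "x = q \<otimes> y \<otimes> q" using Cons(3) by auto
    then obtain as s bs where *: "ws = as @ s # bs" "y = wprod as \<otimes> s \<otimes> inv (wprod as)"
      using Cons.IH[of y] Cons.prems by (auto simp: subset_iff)
    show ?thesis
      using * y Cons(2) by (intro exI[of _ "q # as"]) (auto simp: m_assoc inv_mult_group)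
  qed
qed simp

text \<open>An odd multiplicity is nonzero, so \<open>x\<close> belongs to some letter of the word,
  and that letter is the one deleted. This is the strong exchange property.\<close>

lemma inversion_deletion:
  assumes "set ws \<subseteq> S" "x \<in> carrier W" "inversion (wprod ws) x"
  obtains as s bs where "ws = as @ s # bs" "x = wprod as \<otimes> s \<otimes> inv (wprod as)"
    "x \<otimes> wprod ws = wprod (as @ bs)"
proof -
  have "count_list (refl_seq ws) x \<noteq> 0"
    using assms inversion_wprod odd_pos by blast
  hence "x \<in> set (refl_seq ws)" by (simp add: count_list_0_iff)
  then obtain as s bs where *: "ws = as @ s # bs" "x = wprod as \<otimes> s \<otimes> inv (wprod as)"
    using refl_seq_deletion assms by blast
  moreover have "x \<otimes> wprod ws = wprod (as @ bs)"
    using * assms by (simp add: m_assoc)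
  ultimately show ?thesis using that by blast
qed

section \<open>Reduced words and the length function\<close>

definition reduced :: "'a list \<Rightarrow> bool" where
  "reduced ws \<longleftrightarrow> set ws \<subseteq> S \<and> length ws = len (wprod ws)"

lemma reduced_expression_iff: "reduced_expression W S ws w \<longleftrightarrow> reduced ws \<and> wprod ws = w"
  unfolding reduced_expression_def reduced_def by (auto simp: in_lists_conv_set)

lemma reduced_subset: "reduced ws \<Longrightarrow> set ws \<subseteq> S"
  by (simp add: reduced_def)

lemma len_wprod_le: "set ws \<subseteq> S \<Longrightarrow> len (wprod ws) \<le> length ws"
  unfolding cox_length_def by (rule Least_le) (auto simp: in_lists_conv_set)

lemma ex_reduced:
  assumes "w \<in> carrier W"
  obtains ws where "reduced ws" "wprod ws = w"
proof -
  obtain us where "set us \<subseteq> S" "wprod us = w" using ex_word assms by blast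
  hence "\<exists>n. \<exists>ws \<in> lists S. wprod ws = w \<and> length ws = n" by (auto simp: in_lists_conv_set)
  hence "\<exists>ws \<in> lists S. wprod ws = w \<and> length ws = len w"
    unfolding cox_length_def by (rule LeastI_ex)
  thus ?thesis using that by (auto simp: reduced_def in_lists_conv_set)
qed

lemma len_mult_le:
  assumes "v \<in> carrier W" "w \<in> carrier W"
  shows "len (v \<otimes> w) \<le> len v + len w"
proof -
  obtain us vs where "reduced us" "wprod us = v" "reduced vs" "wprod vs = w"
    using ex_reduced assms by metis
  thus ?thesis using len_wprod_le[of "us @ vs"] by (auto simp: reduced_def)
qed

lemma len_inv [simp]:
  assumes "w \<in> carrier W"
  shows "len (inv w) = len w"
proof -
  have "len (inv v) \<le> len v" if "v \<in> carrier W" for v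
  proof -
    obtain vs where "reduced vs" "wprod vs = v" using ex_reduced \<open>v \<in> _\<close> by blast
    thus ?thesis using len_wprod_le[of "rev vs"] by (simp add: wprod_rev reduced_def)
  qed
  from this[of w] this[of "inv w"] show ?thesis using assms by simp
qed

lemma len_zero_iff [simp]: "w \<in> carrier W \<Longrightarrow> len w = 0 \<longleftrightarrow> w = \<one>"
proof
  assume w: "w \<in> carrier W" "len w = 0"
  obtain ws where "reduced ws" "wprod ws = w" using ex_reduced w by blast
  thus "w = \<one>" using w by (auto simp: reduced_def)
next
  assume "w = \<one>"
  thus "len w = 0" using len_wprod_le[of "[]"] by simp
qed

lemma len_one [simp]: "len \<one> = 0" by simp

lemma len_gen [simp]: "s \<in> S \<Longrightarrow> len s = 1"
  using len_wprod_le[of "[s]"] len_zero_iff[of s] gen_ne_one[of s] by (simp add: le_Suc_eq)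

lemma len_eq_1_iff: "w \<in> carrier W \<Longrightarrow> len w = 1 \<longleftrightarrow> w \<in> S"
proof
  assume w: "w \<in> carrier W" "len w = 1"
  obtain ws where "reduced ws" "wprod ws = w" using ex_reduced w by blast
  thus "w \<in> S" using w by (auto simp: reduced_def length_Suc_conv)
qed simp

lemma inversion_imp_less:
  assumes "w \<in> carrier W" "x \<in> carrier W" "inversion w x"
  shows "len (x \<otimes> w) < len w"
proof -
  obtain ws where ws: "reduced ws" "wprod ws = w" using ex_reduced assms by blast
  then obtain as s bs where "ws = as @ s # bs" "x \<otimes> wprod ws = wprod (as @ bs)"
    using inversion_deletion[of ws x] assms reduced_subset[OF ws(1)] by metis
  thus ?thesis using len_wprod_le[of "as @ bs"] ws by (auto simp: reduced_def)
qed

text \<open>Since \<open>x\<close> inverts itself, the cocycle rule makes it an inversion of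
  \<open>x w\<close>, and \<open>inversion_imp_less\<close> applies to that element.\<close>

lemma not_inversion_imp_less:
  assumes "w \<in> carrier W" "x \<in> reflections" "\<not> inversion w x"
  shows "len w < len (x \<otimes> w)"
proof -
  have "inversion (x \<otimes> w) x"
    using assms inversion_mult[of x w x] inversion_reflection by simp
  from inversion_imp_less[OF _ _ this] show ?thesis using assms by simp
qed

lemma inversion_iff:
  assumes "w \<in> carrier W" "x \<in> reflections"
  shows "inversion w x \<longleftrightarrow> len (x \<otimes> w) < len w"
  using inversion_imp_less not_inversion_imp_less assms by (meson not_less_iff_gr_or_eq reflection_closed)

lemma not_inversion_iff:
  assumes "w \<in> carrier W" "x \<in> reflections"
  shows "\<not> inversion w x \<longleftrightarrow> len w < len (x \<otimes> w)"
  using inversion_imp_less not_inversion_imp_less assms by (meson not_less_iff_gr_or_eq reflection_closed)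

lemma len_mult_reflection_neq:
  assumes "w \<in> carrier W" "x \<in> reflections"
  shows "len (x \<otimes> w) \<noteq> len w"
  using inversion_iff[OF assms] not_inversion_iff[OF assms] by auto

end

section \<open>Length, support and the longest element\<close>

context coxeter_system
begin

lemma reduced_Nil [simp]: "reduced []" by (simp add: reduced_def)

lemma reduced_appendD:
  assumes "reduced (us @ vs)"
  shows "reduced us" "reduced vs"
proof -
  have S: "set us \<subseteq> S" "set vs \<subseteq> S" using assms by (auto simp: reduced_def)
  have "len (wprod (us @ vs)) \<le> len (wprod us) + len (wprod vs)"
    using S len_mult_le by simp
  moreover have "len (wprod us) \<le> length us" "len (wprod vs) \<le> length vs"
    using S len_wprod_le by auto
  ultimately show "reduced us" "reduced vs" using assms S by (auto simp: reduced_def)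
qed

lemma reduced_ConsD: "reduced (s # ws) \<Longrightarrow> reduced ws"
  using reduced_appendD[of "[s]" ws] by simp

lemma reduced_Cons_iff:
  "reduced (s # ws) \<longleftrightarrow> s \<in> S \<and> reduced ws \<and> len (wprod ws) < len (s \<otimes> wprod ws)"
proof
  assume r: "reduced (s # ws)"
  hence "reduced ws" by (rule reduced_ConsD)
  thus "s \<in> S \<and> reduced ws \<and> len (wprod ws) < len (s \<otimes> wprod ws)"
    using r by (simp add: reduced_def)
next
  assume r: "s \<in> S \<and> reduced ws \<and> len (wprod ws) < len (s \<otimes> wprod ws)"
  thus "reduced (s # ws)" using len_wprod_le[of "s # ws"] by (simp add: reduced_def)
qed

lemma len_right: "\<lbrakk>w \<in> carrier W; x \<in> reflections\<rbrakk> \<Longrightarrow> len (w \<otimes> x) = len (x \<otimes> inv w)"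
  using len_inv[of "w \<otimes> x"] by (simp add: inv_mult_group del: len_inv)

lemma len_right_neq: "\<lbrakk>w \<in> carrier W; x \<in> reflections\<rbrakk> \<Longrightarrow> len (w \<otimes> x) \<noteq> len w"
  using len_mult_reflection_neq[of "inv w" x] len_right[of w x] by simp

lemma left_exchange:
  assumes "set ws \<subseteq> S" "x \<in> reflections" "len (x \<otimes> wprod ws) < len (wprod ws)"
  obtains as s bs where "ws = as @ s # bs" "x = wprod as \<otimes> s \<otimes> inv (wprod as)"
    "x \<otimes> wprod ws = wprod (as @ bs)"
  using inversion_deletion[of ws x] inversion_iff[of "wprod ws" x] assms
  by (metis gen_word_closed reflection_closed word_prod_closed)

lemma right_exchange:
  assumes "set ws \<subseteq> S" "x \<in> reflections" "len (wprod ws \<otimes> x) < len (wprod ws)"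
  obtains as s bs where "ws = as @ s # bs" "x = inv (wprod bs) \<otimes> s \<otimes> wprod bs"
    "wprod ws \<otimes> x = wprod (as @ bs)"
proof -
  have "len (x \<otimes> wprod (rev ws)) < len (wprod (rev ws))"
    using assms len_right[of "wprod ws" x] by (simp add: wprod_rev)
  then obtain as s bs where *: "rev ws = as @ s # bs" "x = wprod as \<otimes> s \<otimes> inv (wprod as)"
    using left_exchange[of "rev ws" x] assms by (metis set_rev)
  have ws: "ws = rev bs @ s # rev as" using *(1) by (simp add: rev_eq_append_conv)
  have S: "set as \<subseteq> S" "set bs \<subseteq> S" "s \<in> S" using assms(1) ws by auto
  have "wprod ws \<otimes> x = wprod (rev bs @ rev as)"
    using ws S *(2) by (simp add: wprod_rev m_assoc)
  thus ?thesis using that[of "rev bs" s "rev as"] ws * S by (simp add: wprod_rev)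
qed

section \<open>Supports and descents\<close>

text \<open>Letters are prepended one by one. Each either keeps the word reduced or, by exchange, is
  absorbed by deleting a letter, so no new letters arise.\<close>

lemma ex_reduced_subset:
  assumes "set ws \<subseteq> S"
  obtains vs where "reduced vs" "wprod vs = wprod ws" "set vs \<subseteq> set ws"
proof -
  have "\<exists>vs. reduced vs \<and> wprod vs = wprod ws \<and> set vs \<subseteq> set ws"
    using assms
  proof (induction ws)
    case (Cons s ws)
    then obtain vs where vs: "reduced vs" "wprod vs = wprod ws" "set vs \<subseteq> set ws" by auto
    show ?case
    proof (cases "len (s \<otimes> wprod vs) < len (wprod vs)")
      case True
      obtain as q bs where *: "vs = as @ q # bs" "s \<otimes> wprod vs = wprod (as @ bs)"
        using left_exchange[of vs s] True reduced_subset[OF vs(1)] Cons(2)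
        by (metis gen_reflection list.set_intros(1) subsetD)
      have S: "set as \<subseteq> S" "set bs \<subseteq> S" "q \<in> S" using vs(1) * by (auto simp: reduced_def)
      have "length vs \<le> Suc (len (wprod (as @ bs)))"
      proof -
        have "wprod vs = s \<otimes> wprod (as @ bs)" using *(2)[symmetric] Cons(2) vs(1)
          by (simp add: reduced_def)
        thus ?thesis using vs(1) len_mult_le[of s "wprod (as @ bs)"] Cons(2) S
          by (simp add: reduced_def)
      qed
      hence "reduced (as @ bs)" using * S len_wprod_le[of "as @ bs"] by (auto simp: reduced_def)
      thus ?thesis using * vs by (intro exI[of _ "as @ bs"]) auto
    next
      case False
      hence "reduced (s # vs)"
        using vs(1) Cons(2) len_mult_reflection_neq[of "wprod vs" s]
        by (auto simp: reduced_Cons_iff reduced_subset)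
      thus ?thesis using vs by (intro exI[of _ "s # vs"]) auto
    qed
  qed auto
  thus ?thesis using that by blast
qed

lemma gen_in_support:
  assumes "s \<in> S" "set ws \<subseteq> S" "s = wprod ws"
  shows "s \<in> set ws"
proof -
  obtain vs where vs: "reduced vs" "wprod vs = wprod ws" "set vs \<subseteq> set ws"
    using ex_reduced_subset assms by blast
  hence "length vs = 1" using assms by (simp add: reduced_def)
  then obtain x where "vs = [x]" by (auto simp: length_Suc_conv)
  thus ?thesis using vs assms by (auto simp: reduced_def)
qed

text \<open>Exchange writes \<open>s\<close> as a conjugate of a letter of \<open>ws\<close> by a
  prefix of \<open>ws\<close>, thus as a word in the letters of \<open>ws\<close>.\<close>

lemma descent_in_support:
  assumes "s \<in> S" "set ws \<subseteq> S" "len (s \<otimes> wprod ws) < len (wprod ws)"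
  shows "s \<in> set ws"
proof -
  obtain as q bs where *: "ws = as @ q # bs" "s = wprod as \<otimes> q \<otimes> inv (wprod as)"
    using left_exchange[of ws s] assms gen_reflection by metis
  hence "s = wprod (as @ [q] @ rev as)" using assms by (simp add: wprod_rev m_assoc)
  thus ?thesis using gen_in_support[of s "as @ [q] @ rev as"] assms * by auto
qed

lemma reduced_head_descent:
  assumes "reduced (s # ws)"
  shows "s \<in> S" "set ws \<subseteq> S" "len (s \<otimes> wprod (s # ws)) < len (wprod (s # ws))"
  using assms by (auto simp: reduced_Cons_iff reduced_subset)

text \<open>The first letter of \<open>us\<close> is a left descent and therefore occurs in
  \<open>vs\<close>. Exchange cancels it from both words, and the induction continues with what is
  left.\<close>

lemma reduced_support:
  assumes "reduced us" "set vs \<subseteq> S" "wprod us = wprod vs"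
  shows "set us \<subseteq> set vs"
  using assms
proof (induction us arbitrary: vs)
  case (Cons s us)
  have s: "s \<in> S" "set us \<subseteq> S" "len (s \<otimes> wprod vs) < len (wprod vs)"
    using reduced_head_descent[OF Cons(2)] unfolding Cons(4) by auto
  hence "s \<in> set vs" using descent_in_support Cons(3) by blast
  moreover obtain as q bs where *: "vs = as @ q # bs" "s \<otimes> wprod vs = wprod (as @ bs)"
    using left_exchange[of vs s] s Cons(3) gen_reflection by metis
  have "wprod us = wprod (as @ bs)" using *(2) Cons(4)[symmetric] s by simp
  hence "set us \<subseteq> set (as @ bs)"
    using Cons(1)[of "as @ bs"] Cons(2,3) * reduced_ConsD by auto
  ultimately show ?case using * by auto
qed simp

lemma distinct_reduced: "\<lbrakk>distinct ws; set ws \<subseteq> S\<rbrakk> \<Longrightarrow> reduced ws"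
proof (induction ws)
  case (Cons s ws)
  hence "\<not> len (s \<otimes> wprod ws) < len (wprod ws)" using descent_in_support by auto
  thus ?case using Cons len_mult_reflection_neq[of "wprod ws" s] by (auto simp: reduced_Cons_iff)
qed simp

lemma reduced_Coxeter_word:
  assumes "coxeter_element W S c" "reduced_expression W S cw c"
  shows "distinct cw" "set cw = S"
proof -
  obtain ws where ws: "distinct ws" "set ws = S" "c = wprod ws"
    using assms(1) by (auto simp: coxeter_element_def)
  have cw: "reduced cw" "wprod cw = c" using assms(2) by (auto simp: reduced_expression_iff)
  have rw: "reduced ws" using ws distinct_reduced by simp
  show set: "set cw = S"
    using reduced_support[OF cw(1), of ws] reduced_support[OF rw, of cw] cw ws reduced_subset by auto
  have "length cw = length ws" using cw rw ws by (simp add: reduced_def)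
  thus "distinct cw" using ws set by (metis card_distinct distinct_card)
qed

text \<open>Every reduced word over \<open>J\<close> begins some reduced word of \<open>w\<close>.
  To add \<open>s\<close>, write \<open>w = xs vs\<close> and apply exchange: deleting a letter of
  \<open>xs\<close> would contradict that \<open>s # xs\<close> is reduced, so a letter of
  \<open>vs\<close> disappears.\<close>

lemma descents_reduced_prefix:
  assumes w: "w \<in> carrier W" and J: "J \<subseteq> S" "\<And>s. s \<in> J \<Longrightarrow> len (s \<otimes> w) < len w"
  shows "\<lbrakk>reduced xs; set xs \<subseteq> J\<rbrakk> \<Longrightarrow> len (inv (wprod xs) \<otimes> w) + length xs = len w"
proof (induction xs)
  case Nil
  show ?case using w by simp
next
  case (Cons s xs)
  have xs: "set xs \<subseteq> S" "s \<in> S" using Cons(3) J by auto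
  obtain vs where vs: "reduced vs" "wprod vs = inv (wprod xs) \<otimes> w"
    using ex_reduced[of "inv (wprod xs) \<otimes> w"] w xs by auto
  have vS: "set vs \<subseteq> S" using vs reduced_subset by auto
  have w_eq: "w = wprod (xs @ vs)" using w xs vs vS by simp
  have len: "len w = length vs + length xs"
    using Cons reduced_ConsD vs by (auto simp: reduced_def)
  obtain as q bs where *: "xs @ vs = as @ q # bs" "s = wprod as \<otimes> q \<otimes> inv (wprod as)"
    "s \<otimes> w = wprod (as @ bs)"
    using left_exchange[of "xs @ vs" s] xs vS J(2)[of s] Cons(3) w_eq by auto
  have S: "set as \<subseteq> S" "q \<in> S" "set bs \<subseteq> S"
    using arg_cong[OF *(1), of set] xs vS by auto
  show ?case
  proof (cases "length as < length xs")
    case True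
    then obtain zs where zs: "xs = as @ q # zs"
      using *(1) by (force simp: append_eq_append_conv2 append_eq_Cons_conv)
    hence "s \<otimes> wprod xs = wprod (as @ zs)" using *(2) xs by (simp add: m_assoc)
    hence "len (s \<otimes> wprod xs) < length xs" using len_wprod_le[of "as @ zs"] xs zs by auto
    hence False using Cons(2) xs by (auto simp: reduced_def)
    thus ?thesis ..
  next
    case False
    then obtain ys where ys: "as = xs @ ys" "vs = ys @ q # bs"
      using *(1) by (auto simp: append_eq_append_conv2 append_eq_Cons_conv Cons_eq_append_conv)
    have "inv (wprod (s # xs)) \<otimes> w = inv (wprod xs) \<otimes> (s \<otimes> w)"
      using xs w by (simp add: inv_mult_group m_assoc)
    also have "\<dots> = wprod (ys @ bs)" using *(3) ys S xs by (simp add: m_assoc)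
    finally have "len (inv (wprod (s # xs)) \<otimes> w) < length vs"
      using len_wprod_le[of "ys @ bs"] ys S by simp
    moreover have "len w \<le> length (s # xs) + len (inv (wprod (s # xs)) \<otimes> w)"
    proof -
      have "w = wprod (s # xs) \<otimes> (inv (wprod (s # xs)) \<otimes> w)"
        using xs w by (simp add: m_assoc inv_mult_group)
      thus ?thesis using len_mult_le[of "wprod (s # xs)" "inv (wprod (s # xs)) \<otimes> w"] xs w
          len_wprod_le[of "s # xs"] by simp
    qed
    ultimately show ?thesis using len by simp
  qed
qed

text \<open>If \<open>a\<close> were a descent of \<open>b a\<close>, exchange would give
  \<open>a = b\<close> or \<open>a = b a b\<close>, and both imply that \<open>a\<close> and
  \<open>b\<close> commute.\<close>

lemma reduced_braid:
  assumes "a \<in> S" "b \<in> S" "a \<otimes> b \<noteq> b \<otimes> a"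
  shows "reduced [a, b, a]"
proof -
  have "\<not> len (a \<otimes> wprod [b, a]) < len (wprod [b, a])"
  proof
    assume "len (a \<otimes> wprod [b, a]) < len (wprod [b, a])"
    then obtain as q bs where *: "[b, a] = as @ q # bs" "a = wprod as \<otimes> q \<otimes> inv (wprod as)"
      using left_exchange[of "[b, a]" a] assms by (metis empty_subsetI gen_reflection insert_subset list.set)
    hence "a = b \<or> a = b \<otimes> a \<otimes> b"
      using assms by (auto simp: Cons_eq_append_conv)
    moreover have "a = b \<otimes> a \<otimes> b \<Longrightarrow> a \<otimes> b = b \<otimes> a"
      using assms by (metis gen_closed gen_square m_assoc m_closed r_one)
    ultimately show False using assms by auto
  qed
  moreover have "reduced [b, a]" using assms by (intro distinct_reduced) auto
  ultimately show ?thesis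
    using assms len_mult_reflection_neq[of "wprod [b, a]" a]
    by (auto simp: reduced_Cons_iff[of a "[b, a]"])
qed

end

section \<open>The longest element of a finite Coxeter group\<close>

locale finite_coxeter_system = coxeter_system +
  assumes finite_carrier: "finite (carrier W)"
begin

abbreviation w0 :: 'a where "w0 \<equiv> longest_element W S"

lemma all_descents_prefix:
  assumes "w \<in> carrier W" "\<And>s. s \<in> S \<Longrightarrow> len (s \<otimes> w) < len w" "x \<in> carrier W"
  shows "len (inv x \<otimes> w) + len x = len w"
proof -
  obtain xs where "reduced xs" "wprod xs = x" using ex_reduced assms by blast
  thus ?thesis using descents_reduced_prefix[of w S xs] assms by (auto simp: reduced_def)
qed

text \<open>This justifies the definite description. An element of maximal length has every
  generator as a left descent, so every element is a prefix of it, and one of equal length coincides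
  with it.\<close>

lemma longest_elementE:
  obtains w where "w \<in> carrier W" "w = w0" "\<And>s. s \<in> S \<Longrightarrow> len (s \<otimes> w) < len w"
proof -
  have "Max (len ` carrier W) \<in> len ` carrier W"
    using finite_carrier by (intro Max_in) auto
  then obtain w where "w \<in> carrier W" "len w = Max (len ` carrier W)" by auto
  hence w: "w \<in> carrier W" "\<And>v. v \<in> carrier W \<Longrightarrow> len v \<le> len w"
    using finite_carrier by auto
  have d: "len (s \<otimes> w) < len w" if "s \<in> S" for s
    using w(2)[of "s \<otimes> w"] len_mult_reflection_neq[of w s] that w(1) by simp
  have "w = w0"
    unfolding longest_element_def
  proof (rule the_equality[symmetric])
    fix v assume v: "v \<in> carrier W \<and> (\<forall>u\<in>carrier W. len u \<le> len v)"
    hence "len v = len w" using w by (simp add: le_antisym)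
    hence "len (inv v \<otimes> w) = 0" using all_descents_prefix[OF w(1) d, of v] v by simp
    hence "inv v \<otimes> w = \<one>" using v w by simp
    thus "v = w" using v w by (metis inv_cancel_left(2) r_one)
  qed (use w in auto)
  thus ?thesis using that w d by blast
qed

lemma w0_closed [simp]: "w0 \<in> carrier W"
  using longest_elementE by blast

lemma w0_descent: "s \<in> S \<Longrightarrow> len (s \<otimes> w0) < len w0"
  using longest_elementE by blast

lemma len_mult_w0: "x \<in> carrier W \<Longrightarrow> len (x \<otimes> w0) + len x = len w0"
  using all_descents_prefix[OF w0_closed w0_descent, of "inv x"] by simp

lemma len_le_w0: "x \<in> carrier W \<Longrightarrow> len x \<le> len w0"
  using len_mult_w0[of x] by simp

lemma eq_w0_if_left_descents:
  assumes "w \<in> carrier W" "\<And>s. s \<in> S \<Longrightarrow> len (s \<otimes> w) < len w"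
  shows "w = w0"
proof -
  have "len (inv w0 \<otimes> w) + len w0 = len w" using all_descents_prefix[OF assms, of w0] by simp
  hence "len (inv w0 \<otimes> w) = 0" using len_le_w0[OF assms(1)] by simp
  hence "inv w0 \<otimes> w = \<one>" using assms by simp
  thus ?thesis using assms by (metis inv_cancel_left(2) r_one w0_closed)
qed

lemma w0_square [simp]: "w0 \<otimes> w0 = \<one>"
  using len_mult_w0[of w0] by simp

lemma w0_inv [simp]: "inv w0 = w0"
  by (rule inv_equality) auto

lemma w0_cancel [simp]: "x \<in> carrier W \<Longrightarrow> w0 \<otimes> (w0 \<otimes> x) = x"
  by (simp flip: m_assoc)

lemma eq_w0_if_right_descents:
  assumes "w \<in> carrier W" "\<And>s. s \<in> S \<Longrightarrow> len (w \<otimes> s) < len w"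
  shows "w = w0"
proof -
  have "inv w = w0"
    using assms len_right[of w] by (intro eq_w0_if_left_descents) auto
  thus ?thesis using assms by (metis inv_inv w0_inv)
qed

lemma w0_mult_len: "x \<in> carrier W \<Longrightarrow> len (w0 \<otimes> x) + len x = len w0"
  using len_mult_w0[of "inv x"] len_inv[of "w0 \<otimes> x"] len_inv[of x]
  by (simp add: inv_mult_group del: len_inv)

text \<open>Multiplication by \<open>w0\<close> on either side complements the length, so
  conjugation preserves it, and elements of length one are generators.\<close>

lemma w0_conj_gen:
  assumes "s \<in> S"
  shows "w0 \<otimes> s \<otimes> w0 \<in> S"
proof -
  have "len (w0 \<otimes> s \<otimes> w0) = 1"
    using len_mult_w0[of "w0 \<otimes> s"] w0_mult_len[of s] assms by simp
  thus ?thesis using assms len_eq_1_iff by simp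
qed

text \<open>Length additivity for the minimal element of a coset of the parabolic subgroup of
  \<open>J\<close>. Passing from \<open>v\<close> to \<open>v^-1 w0\<close> turns missing right
  descents into left descents, and \<open>descents_reduced_prefix\<close> applies.\<close>

lemma len_mult_no_descents:
  assumes v: "v \<in> carrier W" and J: "J \<subseteq> S" "\<And>s. s \<in> J \<Longrightarrow> len v < len (v \<otimes> s)"
    and xs: "set xs \<subseteq> J"
  shows "len (v \<otimes> wprod xs) = len v + len (wprod xs)"
proof -
  have xS: "set xs \<subseteq> S" using J xs by auto
  obtain ys where ys: "reduced ys" "wprod ys = wprod xs" "set ys \<subseteq> set xs"
    using ex_reduced_subset[OF xS] by blast
  define w where "w = inv v \<otimes> w0"
  have w: "w \<in> carrier W" using v by (simp add: w_def)
  have flip: "len (inv x \<otimes> w) + len (v \<otimes> x) = len w0" if "x \<in> carrier W" for x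
    using len_mult_w0[of "inv (v \<otimes> x)"] len_inv[of "v \<otimes> x"] v that
    by (simp add: w_def inv_mult_group m_assoc del: len_inv)
  have "len (s \<otimes> w) < len w" if "s \<in> J" for s
    using flip[of s] flip[of \<one>] J(2)[OF that] J(1) that v w by (simp add: subset_iff)
  hence "len (inv (wprod ys) \<otimes> w) + length ys = len w"
    using descents_reduced_prefix[OF w J(1) _ ys(1)] ys xs by blast
  thus ?thesis using flip[of "wprod ys"] flip[of \<one>] ys v w xS by (auto simp: reduced_def)
qed

end

section \<open>Factorizations of products of distinct generators\<close>

context coxeter_system
begin

section \<open>Dihedral subgroups generated by two reflections\<close>

text \<open>The reflections of the dihedral group with rotation \<open>t u\<close>. Integer
  exponents also cover a rotation of infinite order.\<close>

definition dihedral_reflections :: "'a \<Rightarrow> 'a \<Rightarrow> 'a set" where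
  "dihedral_reflections t u = {(t \<otimes> u) [^] i \<otimes> t | i :: int. True}"

context
  fixes t u :: 'a
  assumes t: "t \<in> reflections" and u: "u \<in> reflections"
begin

lemma dihedral_swap_nat: "t \<otimes> (t \<otimes> u) [^] (n::nat) = inv ((t \<otimes> u) [^] n) \<otimes> t"
proof (induction n)
  case 0
  show ?case using t by simp
next
  case (Suc n)
  let ?d = "t \<otimes> u"
  have "t \<otimes> ?d [^] Suc n = (t \<otimes> ?d [^] n) \<otimes> ?d" using t u by (simp add: m_assoc)
  also have "\<dots> = inv (?d [^] n) \<otimes> (inv ?d \<otimes> t)"
    using t u Suc by (simp add: m_assoc inv_mult_group)
  also have "\<dots> = inv (?d \<otimes> ?d [^] n) \<otimes> t" using t u by (simp add: m_assoc inv_mult_group)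
  also have "?d \<otimes> ?d [^] n = ?d [^] Suc n"
    using t u by (simp only: nat_pow_Suc2 m_closed reflection_closed)
  finally show ?case .
qed

lemma dihedral_swap: "t \<otimes> (t \<otimes> u) [^] (i::int) = (t \<otimes> u) [^] (- i) \<otimes> t"
proof (cases i rule: int_cases2)
  case (nonneg n)
  thus ?thesis using dihedral_swap_nat[of n] t u by (simp add: int_pow_int int_pow_neg)
next
  case (nonpos n)
  let ?D = "(t \<otimes> u) [^] n"
  have "?D \<otimes> t \<otimes> ?D = t" using dihedral_swap_nat[of n] t u by (simp add: m_assoc)
  hence "?D \<otimes> t = t \<otimes> inv ?D"
    using t u by (metis inv_solve_right m_closed nat_pow_closed reflection_closed)
  thus ?thesis using nonpos t u by (simp add: int_pow_int int_pow_neg)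
qed

lemma dihedralI: "x = (t \<otimes> u) [^] (i::int) \<otimes> t \<Longrightarrow> x \<in> dihedral_reflections t u"
  unfolding dihedral_reflections_def by blast

lemma dihedralE:
  assumes "x \<in> dihedral_reflections t u"
  obtains i :: int where "x = (t \<otimes> u) [^] i \<otimes> t"
  using assms unfolding dihedral_reflections_def by blast

lemma dihedral_pow_mult:
  "z \<in> carrier W \<Longrightarrow>
    (t \<otimes> u) [^] (i::int) \<otimes> ((t \<otimes> u) [^] (j::int) \<otimes> z) = (t \<otimes> u) [^] (i + j) \<otimes> z"
  using t u by (simp add: int_pow_mult m_assoc)

lemma dihedral_swap_left:
  "z \<in> carrier W \<Longrightarrow>
    t \<otimes> ((t \<otimes> u) [^] (i::int) \<otimes> z) = (t \<otimes> u) [^] (- i) \<otimes> (t \<otimes> z)"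
  using dihedral_swap[of i] t u
  by (metis int_pow_closed m_assoc m_closed reflection_closed)

lemma dihedral_fst: "t \<in> dihedral_reflections t u"
  using t by (intro dihedralI[of _ 0]) simp

text \<open>Exponents \<open>2 j\<close> give conjugates of \<open>t\<close> by
  \<open>(t u)^j\<close>, and exponents \<open>2 j + 1\<close> give conjugates of
  \<open>t u t\<close>.\<close>

lemma dihedral_subset: "dihedral_reflections t u \<subseteq> reflections"
proof
  fix x assume "x \<in> dihedral_reflections t u"
  then obtain i :: int where x: "x = (t \<otimes> u) [^] i \<otimes> t" by (rule dihedralE)
  show "x \<in> reflections"
  proof (cases "even i")
    case True
    then obtain j where "i = j + j" by (metis evenE mult_2)
    hence "x = (t \<otimes> u) [^] j \<otimes> t \<otimes> inv ((t \<otimes> u) [^] j)"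
      using x t u by (simp add: m_assoc dihedral_swap int_pow_neg[symmetric] dihedral_pow_mult)
    thus ?thesis using reflection_conj[of t "(t \<otimes> u) [^] j"] t u by simp
  next
    case False
    then obtain j where j: "i = j + 1 + j" by (metis oddE mult_2 add.assoc add.commute)
    have "(t \<otimes> u) [^] j \<otimes> (t \<otimes> u \<otimes> t) \<otimes> inv ((t \<otimes> u) [^] j)
        = (t \<otimes> u) [^] j \<otimes> ((t \<otimes> u) [^] (1::int) \<otimes> (t \<otimes> (t \<otimes> u) [^] (- j)))"
      using t u by (simp add: m_assoc int_pow_neg)
    also have "\<dots> = x"
      using x j t u by (simp add: dihedral_swap dihedral_pow_mult add.assoc del: int_pow_1)
    finally have "x = (t \<otimes> u) [^] j \<otimes> (t \<otimes> u \<otimes> t) \<otimes> inv ((t \<otimes> u) [^] j)" by simp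
    moreover have "t \<otimes> u \<otimes> t \<in> reflections" using reflection_conj[of u t] t u by simp
    ultimately show ?thesis using reflection_conj[of "t \<otimes> u \<otimes> t" "(t \<otimes> u) [^] j"] t u by simp
  qed
qed

lemma dihedral_conj:
  assumes "x \<in> dihedral_reflections t u" "y \<in> dihedral_reflections t u"
  shows "x \<otimes> y \<otimes> x \<in> dihedral_reflections t u"
proof -
  obtain i j :: int where ij: "x = (t \<otimes> u) [^] i \<otimes> t" "y = (t \<otimes> u) [^] j \<otimes> t"
    using assms by (meson dihedralE)
  have "x \<otimes> y \<otimes> x = (t \<otimes> u) [^] (i + - j + i) \<otimes> t"
    using t u by (simp add: ij m_assoc dihedral_swap_left dihedral_pow_mult add.assoc)
  thus ?thesis by (rule dihedralI)
qed

lemma dihedral_mult: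
  assumes "x \<in> dihedral_reflections t u"
  shows "x \<otimes> (t \<otimes> u) \<in> dihedral_reflections t u" "x \<otimes> inv (t \<otimes> u) \<in> dihedral_reflections t u"
    "(t \<otimes> u) \<otimes> x \<in> dihedral_reflections t u"
proof -
  obtain i :: int where i: "x = (t \<otimes> u) [^] i \<otimes> t" using assms by (meson dihedralE)
  have *: "t \<otimes> u = (t \<otimes> u) [^] (1::int)" "inv (t \<otimes> u) = (t \<otimes> u) [^] (-1::int)"
    using t u by (simp_all add: int_pow_neg)
  have "x \<otimes> (t \<otimes> u) [^] (1::int) = (t \<otimes> u) [^] (i + - 1) \<otimes> t"
    "x \<otimes> (t \<otimes> u) [^] (-1::int) = (t \<otimes> u) [^] (i + 1) \<otimes> t"
    "(t \<otimes> u) [^] (1::int) \<otimes> x = (t \<otimes> u) [^] (1 + i) \<otimes> t"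
    using t u by (simp_all add: i m_assoc dihedral_swap dihedral_pow_mult del: int_pow_1)
  thus "x \<otimes> (t \<otimes> u) \<in> dihedral_reflections t u" "x \<otimes> inv (t \<otimes> u) \<in> dihedral_reflections t u"
    "(t \<otimes> u) \<otimes> x \<in> dihedral_reflections t u"
    unfolding *(2) by (metis *(1) dihedralI)+
qed

lemma dihedral_in_subgroup:
  assumes "subgroup H W" "x \<in> dihedral_reflections t u" "x \<in> H" "t \<otimes> u \<in> H"
  shows "t \<in> H" "u \<in> H"
proof -
  obtain i :: int where i: "x = (t \<otimes> u) [^] i \<otimes> t" using assms by (meson dihedralE)
  have "(t \<otimes> u) [^] (- i) \<in> H"
    using assms by (intro subgroup_int_pow_closed)
  moreover have "t = (t \<otimes> u) [^] (- i) \<otimes> x" using t u by (simp add: i dihedral_pow_mult)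
  ultimately show tH: "t \<in> H" using assms by (metis subgroup.m_closed)
  have "u = t \<otimes> (t \<otimes> u)" using t u by simp
  thus "u \<in> H" using tH assms by (metis subgroup.m_closed)
qed

text \<open>
  The reflections in a dihedral group contain a conjugate \<open>k s k\<inverse>\<close> of a generator \<open>s\<close> with \<open>k\<close> of
  minimal length, and no reflection of the dihedral group is an inversion of \<open>k\<close>; so
  \<open>k s k\<inverse>\<close> behaves inside the dihedral group like a simple reflection.
\<close>

lemma dihedral_canonical_generator:
  obtains r where "r \<in> dihedral_reflections t u"
    "\<And>x. x \<in> dihedral_reflections t u \<Longrightarrow> inversion r x \<longleftrightarrow> x = r"
proof -
  let ?R = "dihedral_reflections t u"
  let ?Q = "\<lambda>k. k \<in> carrier W \<and> (\<exists>s\<in>S. k \<otimes> s \<otimes> inv k \<in> ?R)"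
  have "\<exists>k. ?Q k" using t dihedral_fst by (metis reflectionsE)
  then obtain k where k: "?Q k" and min: "\<And>k'. ?Q k' \<Longrightarrow> len k \<le> len k'"
    using ex_has_least_nat[of ?Q _ len] by blast
  then obtain s where s: "s \<in> S" "k \<otimes> s \<otimes> inv k \<in> ?R" by blast
  define r where "r = k \<otimes> s \<otimes> inv k"
  have r: "r \<in> ?R" "r \<in> reflections" using s dihedral_subset by (auto simp: r_def)
  have ninv: "\<not> inversion k x" if x: "x \<in> ?R" for x
  proof
    assume "inversion k x"
    moreover have xr: "x \<in> reflections" using x dihedral_subset by auto
    ultimately have "len (x \<otimes> k) < len k" using inversion_iff k by blast
    moreover have "(x \<otimes> k) \<otimes> s \<otimes> inv (x \<otimes> k) = x \<otimes> r \<otimes> x"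
      using k s xr by (simp add: r_def inv_mult_group m_assoc)
    hence "?Q (x \<otimes> k)"
      using dihedral_conj[OF x r(1)] k s(1) xr by (metis m_closed reflection_closed)
    ultimately show False using min by fastforce
  qed
  have "inversion r x \<longleftrightarrow> x = r" if x: "x \<in> ?R" for x
  proof -
    have xr: "x \<in> reflections" using x dihedral_subset by auto
    have rk: "r \<otimes> k = k \<otimes> s" using k s by (simp add: r_def m_assoc)
    have "inversion (r \<otimes> k) x \<longleftrightarrow> inversion r x"
      using inversion_mult[of r k x] ninv[OF dihedral_conj[OF r(1) x]] r k xr by simp
    moreover have "inversion (k \<otimes> s) x \<longleftrightarrow> inv k \<otimes> x \<otimes> k = s"
      using inversion_mult[of k s x] ninv[OF x] k s xr inversion_gen by simp
    moreover have "inv k \<otimes> x \<otimes> k = s \<longleftrightarrow> x = r"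
      using k s xr by (auto simp: r_def m_assoc)
    ultimately show ?thesis using rk by simp
  qed
  thus ?thesis using that r by blast
qed

text \<open>With \<open>d = t u\<close>, the cocycle rule shows that \<open>d^-1\<close> has no
  inversion in the dihedral group. For the canonical generator \<open>r\<close>, the reflection
  \<open>r d^-1\<close> inverts itself, which is then due to \<open>r\<close> alone. Hence
  \<open>r d^-1 = r\<close> and \<open>d\<close> is trivial.\<close>

lemma dihedral_unique_minimal:
  assumes "h \<in> carrier W" "\<And>x. x \<in> dihedral_reflections t u \<Longrightarrow> \<not> inversion h x"
    "\<And>x. x \<in> dihedral_reflections t u \<Longrightarrow> \<not> inversion (inv (t \<otimes> u) \<otimes> h) x"
  shows "t = u"
proof -
  let ?R = "dihedral_reflections t u"
  define d where "d = t \<otimes> u"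
  have d: "d \<in> carrier W" using t u by (simp add: d_def)
  have nd: "\<not> inversion (inv d) x" if x: "x \<in> ?R" for x
  proof -
    have "d \<otimes> x \<otimes> inv d \<in> ?R"
      using dihedral_mult x by (simp add: d_def)
    thus ?thesis
      using inversion_mult[of "inv d" h x] assms x d dihedral_subset by (auto simp: d_def)
  qed
  obtain r where r: "r \<in> ?R" "\<And>x. x \<in> ?R \<Longrightarrow> inversion r x \<longleftrightarrow> x = r"
    using dihedral_canonical_generator by blast
  have rr: "r \<in> reflections" using r dihedral_subset by auto
  have rd: "r \<otimes> inv d \<in> ?R" using dihedral_mult r by (simp add: d_def)
  hence "inversion (r \<otimes> inv d) (r \<otimes> inv d)" using inversion_reflection dihedral_subset by blast
  hence "inversion r (r \<otimes> inv d) \<noteq> inversion (inv d) (r \<otimes> (r \<otimes> inv d) \<otimes> r)"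
    using inversion_mult[of r "inv d" "r \<otimes> inv d"] rr d by simp
  hence "r \<otimes> inv d = r" using nd[OF dihedral_conj[OF r(1) rd]] r(2)[OF rd] by simp
  moreover have "inv d = r \<otimes> (r \<otimes> inv d)" using rr d by simp
  ultimately have "inv d = \<one>" using rr by simp
  hence "d = \<one>" using d by (simp add: inv_eq_1_iff)
  moreover have "u = t \<otimes> d" using t u by (simp add: d_def)
  ultimately show ?thesis using t by simp
qed

end

text \<open>The path from \<open>g\<close> over \<open>g t\<close> to \<open>g t u\<close> is
  rerouted below its peak. As \<open>t\<close> and \<open>u\<close> differ, the two ends cannot both
  be free of dihedral descents; one step down from an end by a dihedral reflection gives the new
  midpoint. The last property lets membership in a subgroup be traced back to the old
  factors.\<close>

lemma peak_reduction:
  assumes g: "g \<in> carrier W" and tu: "t \<in> reflections" "u \<in> reflections" "t \<noteq> u"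
    and up: "len g < len (g \<otimes> t)" and down: "len (g \<otimes> t \<otimes> u) < len (g \<otimes> t)"
  obtains t' u' where "t' \<in> reflections" "u' \<in> reflections" "t' \<otimes> u' = t \<otimes> u"
    "len (g \<otimes> t') < len (g \<otimes> t)"
    "\<And>H. \<lbrakk>subgroup H W; t' \<in> H; u' \<in> H\<rbrakk> \<Longrightarrow> t \<in> H \<and> u \<in> H"
proof -
  let ?R = "dihedral_reflections t u" and ?d = "t \<otimes> u"
  note sub = dihedral_subset[OF tu(1,2)]
  have d: "?d \<in> carrier W" using tu by simp
  have inv_len: "inversion (inv v) x \<longleftrightarrow> len (v \<otimes> x) < len v" if "v \<in> carrier W" "x \<in> ?R" for v x
    using inversion_iff[of "inv v" x] len_right[of v x] that sub by auto
  have "inv (g \<otimes> ?d) = inv ?d \<otimes> inv g" using g d by (simp add: inv_mult_group)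
  then consider x where "x \<in> ?R" "inversion (inv g) x" | x where "x \<in> ?R" "inversion (inv (g \<otimes> ?d)) x"
    using dihedral_unique_minimal[OF tu(1,2), of "inv g"] g tu(3) by (metis inv_closed)
  thus ?thesis
  proof cases
    case 1
    have x: "x \<in> reflections" using 1 sub by auto
    have xd: "x \<otimes> ?d \<in> reflections" using dihedral_mult(1)[OF tu(1,2) 1(1)] sub by auto
    have "t \<in> H \<and> u \<in> H" if H: "subgroup H W" "x \<in> H" "x \<otimes> ?d \<in> H" for H
    proof -
      have "?d \<in> H" using subgroup.m_closed[OF H] x d by simp
      thus ?thesis using dihedral_in_subgroup[OF tu(1,2) H(1) 1(1) H(2)] by blast
    qed
    moreover have "len (g \<otimes> x) < len (g \<otimes> t)" using inv_len[OF g 1(1)] 1(2) up by simp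
    moreover have "x \<otimes> (x \<otimes> ?d) = ?d" using x d by simp
    ultimately show ?thesis using that[of x "x \<otimes> ?d"] x xd by blast
  next
    case 2
    have x: "x \<in> reflections" using 2 sub by auto
    have dx: "?d \<otimes> x \<in> reflections" using dihedral_mult(3)[OF tu(1,2) 2(1)] sub by auto
    have eq: "?d \<otimes> x \<otimes> x = ?d" using x tu by (simp add: m_assoc)
    have "t \<in> H \<and> u \<in> H" if H: "subgroup H W" "?d \<otimes> x \<in> H" "x \<in> H" for H
    proof -
      have "?d \<in> H" using subgroup.m_closed[OF H] eq by simp
      thus ?thesis using dihedral_in_subgroup[OF tu(1,2) H(1) 2(1) H(3)] by blast
    qed
    moreover have "len (g \<otimes> (?d \<otimes> x)) < len (g \<otimes> t)"
      using inv_len[of "g \<otimes> ?d" x] 2 g x tu down by (simp add: m_assoc)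
    ultimately show ?thesis using that[of "?d \<otimes> x" x] x dx eq by blast
  qed
qed

section \<open>Factorizations into reflections and parabolic subgroups\<close>

text \<open>Part of the termination measure for removing peaks.\<close>

fun path_weight :: "'a \<Rightarrow> 'a list \<Rightarrow> nat" where
  "path_weight g [] = 0"
| "path_weight g (t # ts) = len (g \<otimes> t) + path_weight (g \<otimes> t) ts"

lemma path_weight_append:
  "\<lbrakk>g \<in> carrier W; set ts \<subseteq> carrier W\<rbrakk> \<Longrightarrow>
    path_weight g (ts @ us) = path_weight g ts + path_weight (g \<otimes> wprod ts) us"
  by (induction ts arbitrary: g) (auto simp: m_assoc)

lemma reflections_word_closed [simp]: "set ts \<subseteq> reflections \<Longrightarrow> set ts \<subseteq> carrier W"
  by auto

text \<open>Undoing the last, length-increasing step deletes a letter of \<open>js\<close> by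
  exchange. So the steps correspond to the letters, and each reflection is a word in letters of
  \<open>js\<close>.\<close>

lemma increasing_factorization_in_parabolic:
  assumes "set ts \<subseteq> reflections" "distinct js" "set js \<subseteq> S" "wprod ts = wprod js"
    "\<And>xs t ys. ts = xs @ t # ys \<Longrightarrow> len (wprod xs) < len (wprod xs \<otimes> t)"
  shows "set ts \<subseteq> generate W (set js) \<and> length ts = length js"
  using assms
proof (induction ts arbitrary: js rule: rev_induct)
  case Nil
  hence "len (wprod js) = 0" by simp
  hence "js = []" using distinct_reduced[of js] Nil by (simp add: reduced_def)
  thus ?case by simp
next
  case (snoc t ts)
  have t: "t \<in> reflections" "set ts \<subseteq> reflections" using snoc(2) by auto
  have eq: "wprod ts \<otimes> t = wprod js" using snoc(5) t by simp
  have ts: "wprod ts = wprod js \<otimes> t" using t by (simp add: eq[symmetric] m_assoc)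
  hence "len (wprod js \<otimes> t) < len (wprod js)" using snoc(6)[of ts t "[]"] eq by simp
  then obtain as s bs where *: "js = as @ s # bs" "t = inv (wprod bs) \<otimes> s \<otimes> wprod bs"
    "wprod js \<otimes> t = wprod (as @ bs)"
    using right_exchange[OF snoc(4) t(1)] by metis
  have abs: "set as \<subseteq> S" "set bs \<subseteq> S" "s \<in> S" using snoc(4) * by auto
  have "set ts \<subseteq> generate W (set (as @ bs)) \<and> length ts = length (as @ bs)"
  proof (rule snoc.IH)
    show "len (wprod xs) < len (wprod xs \<otimes> t')" if "ts = xs @ t' # ys" for xs t' ys
      using snoc(6)[of xs t' "ys @ [t]"] that by simp
  qed (use snoc t * ts in auto)
  moreover have "generate W (set (as @ bs)) \<subseteq> generate W (set js)"
    using * by (intro mono_generate) auto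
  moreover have "t \<in> generate W (set js)"
  proof -
    have H: "subgroup (generate W (set js)) W" using snoc(4) by (intro generate_is_subgroup) simp
    have "wprod xs \<in> generate W (set js)" if "set xs \<subseteq> set js" for xs
      using that by (induction xs) (auto intro: generate.intros)
    from this[of bs] this[of "[s]"] have "wprod bs \<in> generate W (set js)" "s \<in> generate W (set js)"
      using * abs by auto
    thus ?thesis using H *(2) by (simp add: subgroup.m_closed subgroup.m_inv_closed)
  qed
  ultimately show ?case using * by auto
qed

text \<open>Peaks in the path of partial products are removed one at a time, by cancelling two equal
  factors or by lowering the peak. Without peaks the path only increases.\<close>

lemma short_factorization_in_parabolic:
  assumes "set ts \<subseteq> reflections" "distinct js" "set js \<subseteq> S" "wprod ts = wprod js"
    "length ts \<le> length js"
  shows "set ts \<subseteq> generate W (set js) \<and> length ts = length js"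
  using assms(1,4,5)
proof (induction "length ts + path_weight \<one> ts" arbitrary: ts rule: less_induct)
  case less
  show ?case
  proof (cases "\<exists>xs t u ys. ts = xs @ t # u # ys \<and> len (wprod xs) < len (wprod xs \<otimes> t)
      \<and> len (wprod xs \<otimes> t \<otimes> u) < len (wprod xs \<otimes> t)")
    case True
    then obtain xs t u ys where ts: "ts = xs @ t # u # ys"
      and peak: "len (wprod xs) < len (wprod xs \<otimes> t)" "len (wprod xs \<otimes> t \<otimes> u) < len (wprod xs \<otimes> t)"
      by blast
    have tu: "t \<in> reflections" "u \<in> reflections" and xys: "set xs \<subseteq> reflections" "set ys \<subseteq> reflections"
      using less(2) ts by auto
    show ?thesis
    proof (cases "t = u")
      case True
      have "wprod (xs @ ys) = wprod ts" using ts True tu xys by simp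
      moreover have "path_weight \<one> (xs @ ys) \<le> path_weight \<one> ts"
        using ts True tu xys by (simp add: path_weight_append m_assoc)
      \<comment> \<open>This case is contradictory: two factors fewer would still have to be
        \<open>length js\<close> many, while \<open>ts\<close> has at most that many.\<close>
      ultimately have "length (xs @ ys) = length js"
        using less(1)[of "xs @ ys"] less(2-4) ts by auto
      thus ?thesis using less(4) ts by simp
    next
      case False
      obtain t' u' where *: "t' \<in> reflections" "u' \<in> reflections" "t' \<otimes> u' = t \<otimes> u"
        "len (wprod xs \<otimes> t') < len (wprod xs \<otimes> t)"
        "\<And>H. \<lbrakk>subgroup H W; t' \<in> H; u' \<in> H\<rbrakk> \<Longrightarrow> t \<in> H \<and> u \<in> H"
        using peak_reduction[OF _ tu False peak] xys
        by (metis reflections_word_closed word_prod_closed)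
      let ?ts = "xs @ t' # u' # ys"
      have tu_eq: "t' \<otimes> (u' \<otimes> z) = t \<otimes> (u \<otimes> z)" if "z \<in> carrier W" for z
        using that *(1,2) tu by (simp add: *(3) flip: m_assoc)
      have "wprod ?ts = wprod ts" using * tu xys ts by (simp add: tu_eq)
      moreover have "path_weight \<one> ?ts < path_weight \<one> ts"
        using ts * tu xys by (simp add: path_weight_append m_assoc)
      ultimately have IH: "set ?ts \<subseteq> generate W (set js) \<and> length ?ts = length js"
        using less(1)[of ?ts] less(2-4) ts * by simp
      have "subgroup (generate W (set js)) W" using assms(3) by (intro generate_is_subgroup) simp
      thus ?thesis using IH *(5) ts by auto
    qed
  next
    case False
    \<comment> \<open>The first step leaves the identity and goes up. A first step down would follow
      a step up and form a peak.\<close>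
    have up: "len (wprod xs) < len (wprod xs \<otimes> t)" if "ts = xs @ t # ys" for xs t ys
      using that
    proof (induction xs arbitrary: t ys rule: rev_induct)
      case Nil
      hence "t \<in> reflections" using less(2) by auto
      thus ?case using len_mult_reflection_neq[of \<one> t] by (simp flip: neq0_conv)
    next
      case (snoc a xs)
      have r: "a \<in> reflections" "t \<in> reflections" "set xs \<subseteq> reflections" using snoc(2) less(2) by auto
      have "len (wprod xs) < len (wprod xs \<otimes> a)" using snoc(1)[of a "t # ys"] snoc(2) by simp
      hence "\<not> len (wprod xs \<otimes> a \<otimes> t) < len (wprod xs \<otimes> a)" using False snoc(2) by auto
      thus ?case using len_right_neq[of "wprod xs \<otimes> a" t] r by simp
    qed
    show ?thesis by (rule increasing_factorization_in_parabolic) (use less assms up in auto)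
  qed
qed

end

section \<open>Source firing and commutation classes\<close>

definition comm_swap :: "('a, 'b) monoid_scheme \<Rightarrow> 'a list \<Rightarrow> 'a list \<Rightarrow> bool" where
  "comm_swap W us vs \<longleftrightarrow>
     (\<exists>xs a b ys. us = xs @ a # b # ys \<and> vs = xs @ b # a # ys \<and> a \<otimes>\<^bsub>W\<^esub> b = b \<otimes>\<^bsub>W\<^esub> a)"

context coxeter_system
begin

section \<open>Commutation classes of words\<close>

lemma wprod_conj:
  "\<lbrakk>g \<in> carrier W; set xs \<subseteq> carrier W\<rbrakk> \<Longrightarrow>
    wprod (map (\<lambda>x. g \<otimes> x \<otimes> inv g) xs) = g \<otimes> wprod xs \<otimes> inv g"
  by (induction xs) (auto simp: m_assoc)

lemma wprod_commute:
  "\<lbrakk>s \<in> carrier W; set xs \<subseteq> carrier W; \<And>x. x \<in> set xs \<Longrightarrow> x \<otimes> s = s \<otimes> x\<rbrakk> \<Longrightarrow>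
    wprod xs \<otimes> s = s \<otimes> wprod xs"
proof (induction xs)
  case (Cons a xs)
  have "wprod (a # xs) \<otimes> s = a \<otimes> (s \<otimes> wprod xs)" using Cons by (simp add: m_assoc)
  also have "\<dots> = (a \<otimes> s) \<otimes> wprod xs" using Cons(2,3) by (simp add: m_assoc)
  also have "\<dots> = s \<otimes> wprod (a # xs)" using Cons(2-4) by (simp add: m_assoc)
  finally show ?case .
qed simp

abbreviation comm_eq :: "'a list \<Rightarrow> 'a list \<Rightarrow> bool" where "comm_eq \<equiv> (comm_swap W)\<^sup>*\<^sup>*"

lemma comm_swapI: "a \<otimes> b = b \<otimes> a \<Longrightarrow> comm_swap W (xs @ a # b # ys) (xs @ b # a # ys)"
  unfolding comm_swap_def by blast

lemma comm_swap_sym: "comm_swap W us vs \<Longrightarrow> comm_swap W vs us"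
  unfolding comm_swap_def by metis

lemma comm_eq_sym: "comm_eq us vs \<Longrightarrow> comm_eq vs us"
  by (induction rule: rtranclp_induct) (auto intro: converse_rtranclp_into_rtranclp comm_swap_sym)

lemma comm_swap_append: "comm_swap W us vs \<Longrightarrow> comm_swap W (xs @ us @ ys) (xs @ vs @ ys)"
proof -
  assume "comm_swap W us vs"
  then obtain as a b bs where *: "us = as @ a # b # bs" "vs = as @ b # a # bs" "a \<otimes> b = b \<otimes> a"
    unfolding comm_swap_def by blast
  show ?thesis using comm_swapI[OF *(3), of "xs @ as" "bs @ ys"] * by simp
qed

lemma comm_eq_append: "comm_eq us vs \<Longrightarrow> comm_eq (xs @ us @ ys) (xs @ vs @ ys)"
  by (induction rule: rtranclp_induct) (auto intro: rtranclp.rtrancl_into_rtrancl comm_swap_append)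

lemma comm_eq_Cons: "comm_eq us vs \<Longrightarrow> comm_eq (x # us) (x # vs)"
  using comm_eq_append[of us vs "[x]" "[]"] by simp

lemma comm_eq_append_cong: "\<lbrakk>comm_eq us us'; comm_eq vs vs'\<rbrakk> \<Longrightarrow> comm_eq (us @ vs) (us' @ vs')"
  using comm_eq_append[of us us' "[]" vs] comm_eq_append[of vs vs' us' "[]"] by simp

lemma comm_eq_move:
  "(\<And>x. x \<in> set xs \<Longrightarrow> x \<otimes> s = s \<otimes> x) \<Longrightarrow> comm_eq (xs @ s # ys) (s # xs @ ys)"
proof (induction xs)
  case (Cons a xs)
  have "comm_eq (a # xs @ s # ys) (a # s # xs @ ys)" using Cons by (intro comm_eq_Cons) auto
  also have "comm_swap W (a # s # xs @ ys) (s # a # xs @ ys)"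
    using comm_swapI[of a s "[]"] Cons by simp
  finally show ?case by simp
qed simp

lemma comm_swap_props:
  assumes "comm_swap W us vs"
  shows "length us = length vs" "set us = set vs" "distinct us \<longleftrightarrow> distinct vs"
    "set us \<subseteq> carrier W \<Longrightarrow> wprod us = wprod vs"
proof -
  obtain as a b bs where *: "us = as @ a # b # bs" "vs = as @ b # a # bs" "a \<otimes> b = b \<otimes> a"
    using assms unfolding comm_swap_def by blast
  show "length us = length vs" "set us = set vs" "distinct us \<longleftrightarrow> distinct vs" using * by auto
  show "wprod us = wprod vs" if "set us \<subseteq> carrier W"
  proof -
    have "a \<otimes> (b \<otimes> wprod bs) = b \<otimes> (a \<otimes> wprod bs)"
      using that * by (simp flip: m_assoc)
    thus ?thesis using that * by simp
  qed
qed

lemma comm_eq_props: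
  assumes "comm_eq us vs"
  shows "length us = length vs" "set us = set vs" "distinct us \<longleftrightarrow> distinct vs"
    "set us \<subseteq> carrier W \<Longrightarrow> wprod us = wprod vs"
  using assms by (induction rule: rtranclp_induct) (auto dest: comm_swap_props)

lemma comm_eq_reduced: "comm_eq us vs \<Longrightarrow> reduced us \<Longrightarrow> reduced vs"
  using comm_eq_props[of us vs] by (simp add: reduced_def)

section \<open>Sources and firing sequences\<close>

definition source :: "'a \<Rightarrow> 'a list \<Rightarrow> bool" where
  "source s c \<longleftrightarrow> s \<in> set c \<and> (\<forall>x \<in> set (takeWhile (\<lambda>x. x \<noteq> s) c). x \<otimes> s = s \<otimes> x)"

text \<open>
  A list enumerating the generators stands for the acyclic orientation of the Coxeter graph in
  which every edge points to its later end.  Firing a source reverses all edges at it.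
\<close>

definition fire :: "'a \<Rightarrow> 'a list \<Rightarrow> 'a list" where
  "fire s c = remove1 s c @ [s]"

fun fireable :: "'a list \<Rightarrow> 'a list \<Rightarrow> bool" where
  "fireable c [] \<longleftrightarrow> True"
| "fireable c (s # Q) \<longleftrightarrow> source s c \<and> fireable (fire s c) Q"

lemma takeWhile_first: "s \<notin> set xs \<Longrightarrow> takeWhile (\<lambda>x. x \<noteq> s) (xs @ s # ys) = xs"
  by (induction xs) auto

lemma source_split_iff:
  assumes "s \<notin> set xs"
  shows "source s (xs @ s # ys) \<longleftrightarrow> (\<forall>x \<in> set xs. x \<otimes> s = s \<otimes> x)"
  using assms by (simp add: source_def takeWhile_first)

lemma sourceE:
  assumes "source s c"
  obtains xs ys where "c = xs @ s # ys" "s \<notin> set xs" "\<And>x. x \<in> set xs \<Longrightarrow> x \<otimes> s = s \<otimes> x"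
proof -
  have "s \<in> set c" using assms by (simp add: source_def)
  then obtain xs ys where "c = xs @ s # ys" "s \<notin> set xs" by (meson split_list_first)
  thus ?thesis using that assms source_split_iff by metis
qed

lemma fire_props:
  assumes "source s c" "distinct c"
  shows "set (fire s c) = set c" "distinct (fire s c)" "length (fire s c) = length c"
proof -
  have s: "s \<in> set c" using assms by (simp add: source_def)
  thus "set (fire s c) = set c" "distinct (fire s c)"
    using assms(2) by (auto simp: fire_def)
  show "length (fire s c) = length c"
    using s by (simp add: fire_def length_remove1) (metis Suc_pred length_pos_if_in_set)
qed

lemma source_wprod:
  assumes "source s c" "set c \<subseteq> carrier W"
  shows "wprod c = s \<otimes> wprod (remove1 s c)"
proof -
  obtain xs ys where *: "c = xs @ s # ys" "s \<notin> set xs" "\<And>x. x \<in> set xs \<Longrightarrow> x \<otimes> s = s \<otimes> x"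
    using assms by (meson sourceE)
  have "wprod xs \<otimes> s = s \<otimes> wprod xs" using * assms by (intro wprod_commute) auto
  hence "wprod xs \<otimes> (s \<otimes> wprod ys) = s \<otimes> (wprod xs \<otimes> wprod ys)"
    using * assms by (simp flip: m_assoc)
  thus ?thesis using * assms by (simp add: remove1_append)
qed

lemma fire_wprod:
  assumes "source s c" "set c \<subseteq> S"
  shows "wprod c \<otimes> s = s \<otimes> wprod (fire s c)"
proof -
  have "s \<in> S" "set (remove1 s c) \<subseteq> S"
    using assms set_remove1_subset[of s c] by (auto simp: source_def)
  thus ?thesis using source_wprod[OF assms(1)] assms by (simp add: fire_def m_assoc)
qed

lemma fireable_append: "fireable c (Q @ R) \<longleftrightarrow> fireable c Q \<and> fireable (fold fire Q c) R"
  by (induction Q arbitrary: c) auto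

lemma fireable_props:
  assumes "fireable c Q" "distinct c"
  shows "set (fold fire Q c) = set c" "distinct (fold fire Q c)" "set Q \<subseteq> set c"
proof -
  have "set (fold fire Q c) = set c \<and> distinct (fold fire Q c) \<and> set Q \<subseteq> set c"
    using assms
  proof (induction Q arbitrary: c)
    case (Cons s Q)
    have "set (fire s c) = set c" "distinct (fire s c)" "s \<in> set c"
      using Cons fire_props[of s c] by (auto simp: source_def)
    thus ?case using Cons.IH[of "fire s c"] Cons.prems by simp
  qed simp
  thus "set (fold fire Q c) = set c" "distinct (fold fire Q c)" "set Q \<subseteq> set c" by auto
qed

lemma fireable_wprod:
  assumes "fireable c Q" "distinct c" "set c \<subseteq> S"
  shows "wprod c \<otimes> wprod Q = wprod Q \<otimes> wprod (fold fire Q c)"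
  using assms
proof (induction Q arbitrary: c)
  case (Cons s Q)
  have s: "source s c" "s \<in> S" "set (fire s c) \<subseteq> S" "distinct (fire s c)"
    using Cons fire_props[of s c] by (auto simp: source_def)
  have QS: "set Q \<subseteq> S" "set (fold fire Q (fire s c)) \<subseteq> S"
    using fireable_props[of "fire s c" Q] Cons(2) s by auto
  have "wprod c \<otimes> wprod (s # Q) = (wprod c \<otimes> s) \<otimes> wprod Q"
    using s QS Cons by (simp add: m_assoc)
  also have "\<dots> = s \<otimes> (wprod (fire s c) \<otimes> wprod Q)"
    using s QS Cons by (simp add: m_assoc fire_wprod)
  also have "\<dots> = s \<otimes> (wprod Q \<otimes> wprod (fold fire Q (fire s c)))"
    using Cons s by simp
  finally show ?case using s QS by (simp add: m_assoc)
qed simp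

lemma source_comm_swap:
  assumes "comm_swap W c d" "source s c"
  shows "source s d"
proof -
  obtain as a b bs where *: "c = as @ a # b # bs" "d = as @ b # a # bs" "a \<otimes> b = b \<otimes> a"
    using assms unfolding comm_swap_def by blast
  show ?thesis using assms(2) *
    by (cases "s \<in> set as") (auto simp: source_def takeWhile_append split: if_splits)
qed

lemma source_comm_eq: "comm_eq c d \<Longrightarrow> source s c \<Longrightarrow> source s d"
  by (induction rule: rtranclp_induct) (auto intro: source_comm_swap)

lemma fire_comm_swap:
  assumes "comm_swap W c d"
  shows "comm_eq (fire s c) (fire s d)"
proof -
  obtain as a b bs where *: "c = as @ a # b # bs" "d = as @ b # a # bs" "a \<otimes> b = b \<otimes> a"
    using assms unfolding comm_swap_def by blast
  have "remove1 s c = remove1 s d \<or> comm_swap W (remove1 s c) (remove1 s d)"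
    using * by (auto simp: remove1_append intro: comm_swapI)
  thus ?thesis using comm_swap_append[of "remove1 s c" "remove1 s d" "[]" "[s]"]
    by (auto simp: fire_def)
qed

lemma fire_comm_eq: "comm_eq c d \<Longrightarrow> comm_eq (fire s c) (fire s d)"
  by (induction rule: rtranclp_induct) (auto intro: rtranclp_trans fire_comm_swap)

lemma fireable_comm_eq: "\<lbrakk>comm_eq c d; fireable c Q\<rbrakk> \<Longrightarrow> fireable d Q"
proof (induction Q arbitrary: c d)
  case (Cons s Q)
  have "source s d" using source_comm_eq Cons(2,3) by auto
  moreover have "fireable (fire s d) Q"
    using Cons(1)[OF fire_comm_eq[OF Cons(2)]] Cons(3) by simp
  ultimately show ?case by simp
qed simp

lemma source_fire_other:
  assumes "source s c" "a \<noteq> s"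
  shows "source s (fire a c)"
proof -
  obtain xs ys where *: "c = xs @ s # ys" "s \<notin> set xs" "\<And>x. x \<in> set xs \<Longrightarrow> x \<otimes> s = s \<otimes> x"
    using assms by (meson sourceE)
  have sub: "set (remove1 a xs) \<subseteq> set xs" by (rule set_remove1_subset)
  have "fire a c = (if a \<in> set xs then remove1 a xs @ s # ys @ [a] else xs @ s # remove1 a ys @ [a])"
    using * assms by (simp add: fire_def remove1_append)
  thus ?thesis using * sub source_split_iff[of s "remove1 a xs" "ys @ [a]"]
      source_split_iff[of s xs "remove1 a ys @ [a]"] by auto
qed

text \<open>Firing \<open>a\<close> changes only edges at \<open>a\<close>, and there is no edge
  between \<open>a\<close> and \<open>b\<close>.\<close>

lemma source_before_fire:
  assumes "source b (fire a c)" "a \<noteq> b" "a \<otimes> b = b \<otimes> a"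
  shows "source b c"
proof -
  have "b \<in> set (remove1 a c)" using assms by (auto simp: source_def fire_def)
  hence "b \<in> set c" using set_remove1_subset by (metis subsetD)
  then obtain xs ys where *: "c = xs @ b # ys" "b \<notin> set xs" by (meson split_list_first)
  have sub: "set (remove1 a xs) \<subseteq> set xs" "set xs \<subseteq> insert a (set (remove1 a xs))"
    by (auto simp: set_remove1_subset) (metis in_set_remove1)
  have "fire a c = (if a \<in> set xs then remove1 a xs @ b # ys @ [a] else xs @ b # remove1 a ys @ [a])"
    using * assms by (simp add: fire_def remove1_append)
  hence "\<forall>x \<in> set xs. x \<otimes> b = b \<otimes> x"
    using assms * sub source_split_iff[of b "remove1 a xs" "ys @ [a]"]
      source_split_iff[of b xs "remove1 a ys @ [a]"] by (auto split: if_splits)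
  thus ?thesis using * source_split_iff by simp
qed

lemma fire_fire_comm:
  assumes "a \<in> set c" "b \<in> set c" "a \<noteq> b" "a \<otimes> b = b \<otimes> a"
  shows "comm_eq (fire b (fire a c)) (fire a (fire b c))"
proof -
  have "fire b (fire a c) = remove1 a (remove1 b c) @ a # b # []"
    "fire a (fire b c) = remove1 a (remove1 b c) @ b # a # []"
    using assms by (auto simp: fire_def remove1_append remove1_commute)
  thus ?thesis using comm_swapI[OF assms(4), of "remove1 a (remove1 b c)" "[]"] by auto
qed

text \<open>Two commuting letters fired in succession are both sources beforehand. Firing them in
  the other order leads to the same orientation, i.e. to a list equal up to commutations.\<close>

lemma fireable_comm_swap:
  assumes "comm_swap W Q R" "fireable c Q"
  shows "fireable c R"
proof -
  obtain as a b bs where *: "Q = as @ a # b # bs" "R = as @ b # a # bs" "a \<otimes> b = b \<otimes> a"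
    using assms unfolding comm_swap_def by blast
  show ?thesis
  proof (cases "a = b")
    case False
    let ?d = "fold fire as c"
    have f: "fireable c as" "source a ?d" "source b (fire a ?d)" "fireable (fire b (fire a ?d)) bs"
      using assms(2) * by (auto simp: fireable_append)
    have b: "source b ?d" using source_before_fire f(3) False *(3) by blast
    have "source a (fire b ?d)" using source_fire_other[OF f(2)] False by metis
    moreover have "fireable (fire a (fire b ?d)) bs"
      using fireable_comm_eq[OF fire_fire_comm f(4)] f(2) b False *(3) by (simp add: source_def)
    ultimately show ?thesis using f b * by (simp add: fireable_append)
  qed (use assms * in auto)
qed

lemma fireable_comm_eq_word: "comm_eq Q R \<Longrightarrow> fireable c Q \<Longrightarrow> fireable c R"
  by (induction rule: rtranclp_induct) (auto intro: fireable_comm_swap)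

lemma sources_commute:
  assumes "source s c" "source a c"
  shows "a \<otimes> s = s \<otimes> a"
proof -
  obtain xs ys where *: "c = xs @ s # ys" "s \<notin> set xs" "\<And>x. x \<in> set xs \<Longrightarrow> x \<otimes> s = s \<otimes> x"
    using assms by (meson sourceE)
  show ?thesis
  proof (cases "a \<in> set xs \<or> a = s")
    case False
    hence "s \<in> set (takeWhile (\<lambda>x. x \<noteq> a) c)" using * by (auto simp: takeWhile_append)
    thus ?thesis using assms(2) by (auto simp: source_def)
  qed (use * in auto)
qed

text \<open>A source stays one until it is fired, and two simultaneous sources are not adjacent in
  the graph.\<close>

lemma fireable_commutes_source:
  "\<lbrakk>fireable c Q; source s c; s \<notin> set Q; x \<in> set Q\<rbrakk> \<Longrightarrow> x \<otimes> s = s \<otimes> x"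
  by (induction Q arbitrary: c) (auto intro: sources_commute source_fire_other)

lemma fireable_source_first:
  assumes "fireable c Q" "source s c" "s \<in> set Q"
  obtains R where "comm_eq Q (s # R)" "fireable c (s # R)"
proof -
  obtain xs ys where *: "Q = xs @ s # ys" "s \<notin> set xs" using assms by (meson split_list_first)
  have "fireable c xs" using assms * by (simp add: fireable_append)
  hence "comm_eq Q (s # xs @ ys)"
    using * assms fireable_commutes_source[of c xs s] by (auto intro: comm_eq_move)
  thus ?thesis using that fireable_comm_eq_word assms by blast
qed

text \<open>A firing sequence remains valid on any induced subgraph containing all fired
  vertices.\<close>

lemma fireable_filter:
  "\<lbrakk>fireable c Q; set Q \<subseteq> X\<rbrakk> \<Longrightarrow> fireable (filter (\<lambda>x. x \<in> X) c) Q"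
proof (induction Q arbitrary: c)
  case (Cons s Q)
  obtain xs ys where *: "c = xs @ s # ys" "s \<notin> set xs" "\<And>x. x \<in> set xs \<Longrightarrow> x \<otimes> s = s \<otimes> x"
    using Cons by (meson sourceE fireable.simps(2))
  have "source s (filter (\<lambda>x. x \<in> X) c)"
    using * Cons(3) source_split_iff[of s "filter (\<lambda>x. x \<in> X) xs"] by simp
  moreover have "fire s (filter (\<lambda>x. x \<in> X) c) = filter (\<lambda>x. x \<in> X) (fire s c)"
    using Cons(3) by (simp add: fire_def filter_remove1)
  ultimately show ?case using Cons by simp
qed simp

end

section \<open>A firing sequence that spells the longest element\<close>

context finite_coxeter_system
begin

text \<open>
  In terms of roots: \<open>u\<close> maps the simple roots of \<open>p\<close> and \<open>t\<close>, which enclose an obtuse angle, to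
  the negative of the simple root of \<open>r\<close> and to a positive root not involving \<open>r\<close>.  These would
  then enclose an acute angle, which is impossible.
\<close>

lemma no_simple_pair_conj:
  assumes S: "p \<in> S" "t \<in> S" "r \<in> S" and nc: "p \<otimes> t \<noteq> t \<otimes> p" and u: "u \<in> carrier W"
    and ru: "r \<otimes> u = u \<otimes> p" and down: "len (u \<otimes> p) < len u" and up: "len u < len (u \<otimes> t)"
    and rt: "len (u \<otimes> t \<otimes> inv u) < len (r \<otimes> (u \<otimes> t \<otimes> inv u))"
  shows False
proof -
  define x where "x = u \<otimes> t \<otimes> inv u"
  have x: "x \<in> reflections" using S u reflectionsI by (simp add: x_def)
  have xu: "x \<otimes> u = u \<otimes> t" using S u by (simp add: x_def m_assoc)
  have r: "r \<in> reflections" "r = u \<otimes> p \<otimes> inv u" using S u ru by (auto simp flip: ru simp: m_assoc)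
  have pt: "p \<noteq> t" using nc by auto
  have ur: "inv u \<otimes> r \<otimes> u = p" using S u ru by (simp add: m_assoc)
  have "inversion u r" using inversion_iff[OF u r(1)] ru down by simp
  hence "inversion (u \<otimes> t) r"
    using inversion_mult[of u t r] u S pt ur by (simp add: inversion_gen)
  moreover have "\<not> inversion x r" using not_inversion_iff[of x r] x r(1) rt by (simp add: x_def)
  \<comment> \<open>The element \<open>u t = x u\<close> inverts \<open>r\<close>, but
    \<open>x\<close> does not, so by the cocycle rule \<open>u\<close> must invert
    \<open>x r x\<close>.\<close>
  ultimately have "inversion u (x \<otimes> r \<otimes> x)"
    using inversion_mult[of x u r] x u r(1) xu by simp
  moreover have "x \<otimes> r \<otimes> x \<otimes> u = u \<otimes> t \<otimes> p \<otimes> t" using S u r(2) by (simp add: x_def m_assoc)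
  ultimately have small: "len (u \<otimes> t \<otimes> p \<otimes> t) < len u"
    using inversion_imp_less[of u "x \<otimes> r \<otimes> x"] x r(1) u by simp
  \<comment> \<open>The candidate for the minimal element of the coset of \<open>u\<close> modulo
    the subgroup generated by \<open>p\<close> and \<open>t\<close>. It remains to see that
    \<open>t\<close> is no right descent of it.\<close>
  define v where "v = u \<otimes> p"
  have v: "v \<in> carrier W" "v \<otimes> p = u" using u S by (simp_all add: v_def m_assoc)
  have "\<not> inversion u x" using not_inversion_iff[OF u x] xu up by simp
  moreover have "r \<otimes> x \<otimes> r \<noteq> r"
  proof
    assume "r \<otimes> x \<otimes> r = r"
    hence "x = r" using x r(1) by (metis m_assoc m_closed r_one reflection_cancel reflection_closed reflection_square)
    hence "t = p" using S u r(2) by (simp add: x_def)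
    thus False using pt by simp
  qed
  ultimately have "\<not> inversion (r \<otimes> u) (r \<otimes> x \<otimes> r)"
    using inversion_mult[of r u "r \<otimes> x \<otimes> r"] S u x by (simp add: inversion_gen m_assoc)
  hence "len v < len (r \<otimes> x \<otimes> r \<otimes> v)"
    using not_inversion_iff[of v "r \<otimes> x \<otimes> r"] reflection_conj[of x r] v(1) ru S x by (simp add: v_def)
  moreover have "r \<otimes> x \<otimes> r \<otimes> v = v \<otimes> t"
    using S u r(2) by (simp add: x_def v_def m_assoc)
  ultimately have "len v < len (v \<otimes> t)" by simp
  moreover have lv: "len v < len (v \<otimes> p)" using down v by (simp add: v_def)
  \<comment> \<open>Lengths add on the minimal element \<open>v\<close>. But
    \<open>v p t p t = u t p t\<close> is shorter than \<open>u\<close>, whose length is at most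
    \<open>len v + 1\<close>; so \<open>p t p t\<close> would be trivial and \<open>p\<close>,
    \<open>t\<close> would commute.\<close>
  ultimately have "len (v \<otimes> wprod [p, t, p, t]) = len v + len (wprod [p, t, p, t])"
    using len_mult_no_descents[of v "{p, t}" "[p, t, p, t]"] v(1) S by auto
  moreover have "v \<otimes> wprod [p, t, p, t] = u \<otimes> t \<otimes> p \<otimes> t"
    using S v by (simp add: m_assoc flip: v(2))
  moreover have "wprod [p, t, p, t] \<noteq> \<one>"
  proof
    assume "wprod [p, t, p, t] = \<one>"
    hence "(p \<otimes> t) \<otimes> (p \<otimes> t) = \<one>" using S by (simp add: m_assoc)
    hence "inv (p \<otimes> t) = p \<otimes> t" using S by (intro inv_equality) auto
    thus False using nc S by (simp add: inv_mult_group)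
  qed
  hence "len (wprod [p, t, p, t]) \<noteq> 0" using S by simp
  moreover have "len u \<le> len v + 1" using len_mult_le[of v p] v S by simp
  ultimately show False using small by simp
qed

text \<open>If \<open>t\<close> were no descent, a suffix \<open>u\<close> of \<open>Q\<close> would
  conjugate the adjacent generators \<open>p\<close> and \<open>t\<close> as in
  \<open>no_simple_pair_conj\<close>. The hypothesis on \<open>u t u^-1\<close> there comes from the
  factorization \<open>ts\<close> of a product of generators other than \<open>r\<close>.\<close>

lemma descent_propagates:
  assumes c: "distinct c" "set c \<subseteq> S" and Q: "fireable c Q" "reduced Q"
    and e: "fold fire Q c = as @ p # bs @ t # ds" and nc: "p \<otimes> t \<noteq> t \<otimes> p"
    and down: "len (wprod Q \<otimes> p) < len (wprod Q)"
  shows "len (wprod Q \<otimes> t) < len (wprod Q)"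
proof (rule ccontr)
  assume contr: "\<not> ?thesis"
  have eS: "set (as @ p # bs @ t # ds) \<subseteq> S" using fireable_props[OF Q(1) c(1)] c(2) e by simp
  hence S: "p \<in> S" "t \<in> S" "set as \<subseteq> S" "set bs \<subseteq> S" "set ds \<subseteq> S" by auto
  have QS: "set Q \<subseteq> S" using Q reduced_subset by auto
  \<comment> \<open>The letter \<open>r\<close> is the one that exchange deletes at the descent
    \<open>p\<close>; the suffix \<open>u = r V\<close> then satisfies \<open>u p = V\<close> and
    \<open>r u = u p\<close>.\<close>
  obtain Z r V where ex: "Q = Z @ r # V" "p = inv (wprod V) \<otimes> r \<otimes> wprod V"
    using right_exchange[OF QS, of p] S down by (metis gen_reflection)
  have ZV: "set Z \<subseteq> S" "set V \<subseteq> S" "r \<in> S" using QS ex by auto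
  define u where "u = wprod (r # V)"
  have u: "u \<in> carrier W" using ZV by (simp add: u_def)
  have up: "u \<otimes> p = wprod V" using ZV ex(2) by (simp add: u_def m_assoc)
  hence ru: "r \<otimes> u = u \<otimes> p" using ZV by (simp add: u_def)
  have Qu: "wprod Q = wprod Z \<otimes> u" using ex(1) ZV by (simp add: u_def)
  have red: "reduced (r # V)" "reduced Z" using reduced_appendD[of Z "r # V"] Q(2) ex(1) by auto
  have lenQ: "len (wprod Q) = len (wprod Z) + len u"
    using Q(2) red ex(1) unfolding reduced_def u_def by (metis length_append)
  have d: "len (u \<otimes> p) < len u"
    using up red(1) len_wprod_le[OF ZV(2)] by (simp add: reduced_def u_def)
  have "len u < len (u \<otimes> t)"
  proof (rule ccontr)
    assume "\<not> len u < len (u \<otimes> t)"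
    hence "len (u \<otimes> t) < len u" using len_right_neq[of u t] u S by simp
    moreover have "len (wprod Q \<otimes> t) \<le> len (wprod Z) + len (u \<otimes> t)"
      using len_mult_le[of "wprod Z" "u \<otimes> t"] Qu u S ZV by (simp add: m_assoc)
    ultimately show False using contr lenQ by simp
  qed
  moreover have "len (u \<otimes> t \<otimes> inv u) < len (r \<otimes> (u \<otimes> t \<otimes> inv u))"
  proof -
    define cz where "cz = fold fire Z c"
    have f: "fireable cz (r # V)" "fireable c Z" using Q(1) ex(1) by (auto simp: cz_def fireable_append)
    have cz: "distinct cz" "set cz \<subseteq> S" using fireable_props[OF f(2) c(1)] c(2) by (auto simp: cz_def)
    have ez: "fold fire (r # V) cz = as @ p # bs @ t # ds" using e ex(1) by (simp add: cz_def)
    define js where "js = remove1 r cz"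
    have sr: "source r cz" using f by simp
    have js: "distinct js" "set js \<subseteq> S" "r \<notin> set js" "wprod cz = r \<otimes> wprod js"
      using cz sr source_wprod[OF sr] set_remove1_subset[of r cz] by (auto simp: js_def)
    \<comment> \<open>Moving \<open>p\<close> to the front of the end list \<open>e\<close>
      conjugates \<open>as\<close> by \<open>p\<close>; then \<open>p\<close> is cancelled and the
      rest is conjugated by \<open>u\<close>. In terms of products,
      \<open>u p e u^-1 = r u e u^-1 = r cz = js\<close>, because \<open>u e = cz u\<close>.\<close>
    define ts where "ts = map (\<lambda>x. u \<otimes> x \<otimes> inv u) (map (\<lambda>x. p \<otimes> x \<otimes> inv p) as @ bs @ t # ds)"
    have set_ts: "set ts \<subseteq> reflections"
      using S u reflection_conj[of _ p] reflection_conj[OF _ u] unfolding ts_def by (auto simp: subset_iff)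
    have "length js + 1 = length cz" 
      using fire_props(3)[OF sr cz(1)] by (simp add: js_def fire_def)
    moreover have "length cz = length (as @ p # bs @ t # ds)"
      using ez fireable_props[OF f(1) cz(1)] cz(1) by (metis distinct_card)
    ultimately have len_ts: "length ts = length js" by (simp add: ts_def)
    have "wprod ts = wprod js"
    proof -
      have "wprod ts = u \<otimes> (p \<otimes> wprod (as @ p # bs @ t # ds)) \<otimes> inv u"
      proof -
        let ?as = "map (\<lambda>x. p \<otimes> x \<otimes> inv p) as"
        have "set ?as \<subseteq> carrier W" using S by auto
        moreover from this have "wprod ts = u \<otimes> wprod (?as @ bs @ t # ds) \<otimes> inv u"
          unfolding ts_def using S u by (intro wprod_conj) auto
        moreover have "wprod ?as = p \<otimes> wprod as \<otimes> inv p" using S by (intro wprod_conj) auto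
        ultimately show ?thesis using S u by (simp add: m_assoc)
      qed
      also have "\<dots> = r \<otimes> (u \<otimes> wprod (as @ p # bs @ t # ds)) \<otimes> inv u"
        using S u ZV eS ru by (simp flip: m_assoc)
      also have "u \<otimes> wprod (as @ p # bs @ t # ds) = wprod cz \<otimes> u"
        using fireable_wprod[OF f(1) cz] ez by (simp add: u_def)
      also have "r \<otimes> (wprod cz \<otimes> u) \<otimes> inv u = wprod js"
        using js u ZV by (simp add: m_assoc)
      finally show ?thesis .
    qed
    hence "set ts \<subseteq> generate W (set js)"
      using short_factorization_in_parabolic[of ts js] set_ts js len_ts by simp
    moreover have "u \<otimes> t \<otimes> inv u \<in> set ts" by (simp add: ts_def)
    ultimately have "u \<otimes> t \<otimes> inv u \<in> generate W (set js)" by blast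
    then obtain gs where gs: "set gs \<subseteq> set js" "wprod gs = u \<otimes> t \<otimes> inv u"
      using generate_word js(2) by metis
    hence "\<not> len (r \<otimes> wprod gs) < len (wprod gs)"
      using descent_in_support[of r gs] js ZV by auto
    thus ?thesis using len_mult_reflection_neq[of "wprod gs" r] gs ZV S u by simp
  qed
  ultimately show False using no_simple_pair_conj[OF S(1,2) ZV(3) nc u ru d] by blast
qed

lemma ex_fireable_w0:
  assumes c: "distinct c" "set c = S"
  obtains Q where "fireable c Q" "reduced Q" "wprod Q = w0"
proof -
  have "\<exists>Q. (fireable c Q \<and> reduced Q) \<and> (\<forall>R. fireable c R \<and> reduced R \<longrightarrow> length R \<le> length Q)"
  proof (rule Lattices_Big.ex_has_greatest_nat)
    show "fireable c [] \<and> reduced []" by simp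
    show "\<forall>R. fireable c R \<and> reduced R \<longrightarrow> length R < Suc (len w0)"
      using len_le_w0 reduced_subset by (auto simp: reduced_def less_Suc_eq_le)
  qed
  then obtain Q where Q: "fireable c Q" "reduced Q"
    and max: "\<And>R. \<lbrakk>fireable c R; reduced R\<rbrakk> \<Longrightarrow> length R \<le> length Q" by blast
  define e where "e = fold fire Q c"
  have e: "set e = S" "distinct e" using fireable_props[OF Q(1) c(1)] c(2) by (auto simp: e_def)
  have QS: "set Q \<subseteq> S" using Q reduced_subset by blast
  \<comment> \<open>Induction on the position of \<open>x\<close>. If \<open>x\<close> commutes with
    all earlier letters it is a source, and maximality of \<open>Q\<close> makes it a descent.
    Otherwise an earlier neighbour is a descent by induction and propagates this to
    \<open>x\<close>.\<close>
  have "len (wprod Q \<otimes> x) < len (wprod Q)" if "e = as @ x # bs" for as x bs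
    using that
  proof (induction "length as" arbitrary: as x bs rule: less_induct)
    case less
    have x: "x \<in> S" "x \<notin> set as" using less(2) e by auto
    show ?case
    proof (cases "\<forall>a \<in> set as. a \<otimes> x = x \<otimes> a")
      case True
      hence "source x e" using less(2) x source_split_iff by simp
      hence "fireable c (Q @ [x])" using Q by (simp add: fireable_append e_def)
      hence "\<not> reduced (Q @ [x])" using max[of "Q @ [x]"] by auto
      hence "len (wprod Q \<otimes> x) \<noteq> Suc (len (wprod Q))"
        using Q(2) x QS by (simp add: reduced_def)
      moreover have "len (wprod Q \<otimes> x) \<le> len (wprod Q) + 1"
        using len_mult_le[of "wprod Q" x] x QS by simp
      ultimately show ?thesis using len_right_neq[of "wprod Q" x] x QS by simp
    next
      case False
      then obtain p where "p \<in> set as" "p \<otimes> x \<noteq> x \<otimes> p" by blast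
      then obtain as' cs where p: "as = as' @ p # cs" "p \<otimes> x \<noteq> x \<otimes> p" by (meson split_list)
      have "len (wprod Q \<otimes> p) < len (wprod Q)"
        using less(1)[of as' p "cs @ x # bs"] less(2) p by simp
      thus ?thesis using descent_propagates[of c Q as' p cs x bs] c Q p less(2) by (simp add: e_def)
    qed
  qed
  hence "len (wprod Q \<otimes> x) < len (wprod Q)" if "x \<in> S" for x
    using that e by (metis split_list)
  hence "wprod Q = w0" using QS by (intro eq_w0_if_right_descents) auto
  thus ?thesis using that Q by blast
qed

end

section \<open>Subword complexes and sorting words\<close>

lemma nths_cong_set:
  assumes "\<And>i. i < length xs \<Longrightarrow> i \<in> A \<longleftrightarrow> i \<in> B"
  shows "nths xs A = nths xs B"
proof -
  have "filter (\<lambda>p. snd p \<in> A) (zip xs [0..<length xs])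
      = filter (\<lambda>p. snd p \<in> B) (zip xs [0..<length xs])"
    using assms by (intro filter_cong) (auto dest: set_zip_rightD)
  thus ?thesis by (simp add: nths_def)
qed

lemma subseq_nths_mono: "A \<subseteq> B \<Longrightarrow> subseq (nths xs A) (nths xs B)"
proof (induction xs arbitrary: A B)
  case (Cons x xs)
  have "subseq (nths xs {j. Suc j \<in> A}) (nths xs {j. Suc j \<in> B})"
    using Cons.prems by (intro Cons.IH) auto
  thus ?case using Cons.prems by (auto simp: nths_Cons)
qed simp

lemma subword_complex_face_iff:
  assumes "P \<subseteq> {..<length Q}"
  shows "P \<in> snd (subword_complex W S Q p) \<longleftrightarrow>
    (\<exists>A \<subseteq> {..<length Q} - P. reduced_expression W S (nths Q A) p)" (is "?L \<longleftrightarrow> ?R")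
proof
  assume ?L
  then obtain ws where ws: "subseq ws (nths Q ({..<length Q} - P))" "reduced_expression W S ws p"
    unfolding subword_complex_def by auto
  then obtain N where "ws = nths (nths Q ({..<length Q} - P)) N" by (auto simp: subseq_conv_nths)
  hence "ws = nths Q {i \<in> {..<length Q} - P. \<exists>j\<in>N. card {i' \<in> {..<length Q} - P. i' < i} = j}"
    by (simp only: nths_nths)
  thus ?R using ws(2)
    by (intro exI[of _ "{i \<in> {..<length Q} - P. \<exists>j\<in>N. card {i' \<in> {..<length Q} - P. i' < i} = j}"]) auto
next
  assume ?R
  then obtain A where A: "A \<subseteq> {..<length Q} - P" "reduced_expression W S (nths Q A) p" by blast
  thus ?L using assms subseq_nths_mono[OF A(1), of Q] unfolding subword_complex_def by auto
qed

text \<open>The bijection preserves the position sets that spell reduced expressions. Faces are the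
  sets disjoint from some such set, so the complexes become isomorphic, and this form is easy to
  check for local changes of words.\<close>

definition word_iso ::
    "('a, 'b) monoid_scheme \<Rightarrow> 'a set \<Rightarrow> 'a \<Rightarrow> 'a list \<Rightarrow> 'a list \<Rightarrow> bool" where
  "word_iso W S p Q R \<longleftrightarrow> (\<exists>f. bij_betw f {..<length Q} {..<length R} \<and>
     (\<forall>A \<subseteq> {..<length Q}.
        reduced_expression W S (nths Q A) p \<longleftrightarrow> reduced_expression W S (nths R (f ` A)) p))"

lemma word_isoI:
  assumes "bij_betw f {..<length Q} {..<length R}"
    "\<And>A. A \<subseteq> {..<length Q} \<Longrightarrow>
      reduced_expression W S (nths Q A) p \<longleftrightarrow> reduced_expression W S (nths R (f ` A)) p"
  shows "word_iso W S p Q R"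
  using assms unfolding word_iso_def by blast

lemma word_iso_refl: "word_iso W S p Q Q"
  by (rule word_isoI[of id]) auto

lemma word_iso_trans:
  assumes "word_iso W S p Q R" "word_iso W S p R T"
  shows "word_iso W S p Q T"
proof -
  obtain f g where f: "bij_betw f {..<length Q} {..<length R}"
      "\<And>A. A \<subseteq> {..<length Q} \<Longrightarrow>
        reduced_expression W S (nths Q A) p \<longleftrightarrow> reduced_expression W S (nths R (f ` A)) p"
    and g: "bij_betw g {..<length R} {..<length T}"
      "\<And>A. A \<subseteq> {..<length R} \<Longrightarrow>
        reduced_expression W S (nths R A) p \<longleftrightarrow> reduced_expression W S (nths T (g ` A)) p"
    using assms unfolding word_iso_def by metis
  show ?thesis
  proof (rule word_isoI[of "g \<circ> f"])
    show "bij_betw (g \<circ> f) {..<length Q} {..<length T}" using bij_betw_trans f(1) g(1) by blast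
    fix A assume A: "A \<subseteq> {..<length Q}"
    hence "f ` A \<subseteq> {..<length R}" using f(1) by (auto simp: bij_betw_def)
    thus "reduced_expression W S (nths Q A) p \<longleftrightarrow> reduced_expression W S (nths T ((g \<circ> f) ` A)) p"
      using f(2)[OF A] g(2) by (simp add: image_comp)
  qed
qed

lemma word_iso_sym:
  assumes "word_iso W S p Q R"
  shows "word_iso W S p R Q"
proof -
  obtain f where f: "bij_betw f {..<length Q} {..<length R}"
      "\<And>A. A \<subseteq> {..<length Q} \<Longrightarrow>
        reduced_expression W S (nths Q A) p \<longleftrightarrow> reduced_expression W S (nths R (f ` A)) p"
    using assms unfolding word_iso_def by metis
  let ?g = "inv_into {..<length Q} f"
  have g: "bij_betw ?g {..<length R} {..<length Q}" using f(1) by (rule bij_betw_inv_into)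
  show ?thesis
  proof (rule word_isoI[OF g])
    fix A assume A: "A \<subseteq> {..<length R}"
    hence "?g ` A \<subseteq> {..<length Q}" using g by (auto simp: bij_betw_def)
    moreover have "f ` (?g ` A) = A"
      using A f(1) by (simp add: image_inv_into_cancel bij_betw_def)
    ultimately show "reduced_expression W S (nths R A) p \<longleftrightarrow> reduced_expression W S (nths Q (?g ` A)) p"
      using f(2)[of "?g ` A"] by simp
  qed
qed

lemma word_iso_complex_isomorphic:
  assumes "word_iso W S p Q R"
  shows "complex_isomorphic (subword_complex W S Q p) (subword_complex W S R p)"
proof -
  obtain f where f: "bij_betw f {..<length Q} {..<length R}"
      "\<And>A. A \<subseteq> {..<length Q} \<Longrightarrow>
        reduced_expression W S (nths Q A) p \<longleftrightarrow> reduced_expression W S (nths R (f ` A)) p"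
    using assms unfolding word_iso_def by metis
  have inj: "inj_on f {..<length Q}" and im: "f ` {..<length Q} = {..<length R}"
    using f(1) by (auto simp: bij_betw_def)
  have fst: "fst (subword_complex W S Q' p) = {..<length Q'}" for Q'
    by (simp add: subword_complex_def)
  have "P \<in> snd (subword_complex W S Q p) \<longleftrightarrow> f ` P \<in> snd (subword_complex W S R p)"
    if P: "P \<subseteq> {..<length Q}" for P
  proof -
    have fP: "f ` P \<subseteq> {..<length R}" using P im by blast
    have "(\<exists>A \<subseteq> {..<length Q} - P. reduced_expression W S (nths Q A) p) \<longleftrightarrow>
      (\<exists>B \<subseteq> {..<length R} - f ` P. reduced_expression W S (nths R B) p)" (is "?L \<longleftrightarrow> ?R")
    proof
      assume ?L
      then obtain A where A: "A \<subseteq> {..<length Q} - P" "reduced_expression W S (nths Q A) p" by blast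
      have "f ` ({..<length Q} - P) = {..<length R} - f ` P"
        using inj_on_image_set_diff[OF inj Diff_subset P] im by simp
      hence "f ` A \<subseteq> {..<length R} - f ` P" using A(1) by blast
      thus ?R using A f(2)[of A] by blast
    next
      assume ?R
      then obtain B where B: "B \<subseteq> {..<length R} - f ` P" "reduced_expression W S (nths R B) p" by blast
      let ?A = "{i \<in> {..<length Q}. f i \<in> B}"
      have "f ` ?A = B"
      proof (intro equalityI subsetI)
        fix b assume b: "b \<in> B"
        hence "b \<in> f ` {..<length Q}" unfolding im using B(1) by blast
        thus "b \<in> f ` ?A" using b by auto
      qed auto
      moreover have "?A \<subseteq> {..<length Q} - P" using B(1) by auto
      ultimately show ?L using B(2) f(2)[of ?A] by (metis (no_types, lifting) Diff_subset subset_trans)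
    qed
    thus ?thesis by (simp only: subword_complex_face_iff[OF P] subword_complex_face_iff[OF fP])
  qed
  thus ?thesis unfolding complex_isomorphic_def fst using f(1) by blast
qed

context coxeter_system
begin

lemma reduced_expression_comm_swap:
  "comm_swap W us vs \<Longrightarrow> reduced_expression W S us p \<longleftrightarrow> reduced_expression W S vs p"
  using comm_swap_props[of us vs] by (auto simp: reduced_expression_iff reduced_def)

text \<open>The two positions are exchanged. A selection containing both spells a word with the two
  letters commuted, and any other selection spells the same word as before.\<close>

lemma word_iso_comm_swap:
  assumes "comm_swap W Q R"
  shows "word_iso W S p Q R"
proof -
  obtain xs a b ys where *: "Q = xs @ a # b # ys" "R = xs @ b # a # ys" "a \<otimes> b = b \<otimes> a"
    using assms unfolding comm_swap_def by blast
  let ?n = "length xs"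
  define f where "f i = (if i = ?n then Suc ?n else if i = Suc ?n then ?n else i)" for i
  have ff: "f (f i) = i" for i by (simp add: f_def)
  have f_image: "i \<in> f ` A \<longleftrightarrow> f i \<in> A" for i A by (metis ff image_iff)
  have "bij_betw f {..<length Q} {..<length R}"
    using ff * by (intro bij_betw_byWitness[where f' = f]) (auto simp: f_def)
  moreover have "reduced_expression W S (nths Q A) p \<longleftrightarrow> reduced_expression W S (nths R (f ` A)) p" for A
  proof -
    have x: "nths xs (f ` A) = nths xs A" by (rule nths_cong_set) (simp add: f_image, simp add: f_def)
    have y: "nths ys {j. Suc (Suc (j + ?n)) \<in> f ` A} = nths ys {j. Suc (Suc (j + ?n)) \<in> A}"
      by (rule nths_cong_set) (simp add: f_image, simp add: f_def)
    have n: "?n \<in> f ` A \<longleftrightarrow> Suc ?n \<in> A" "Suc ?n \<in> f ` A \<longleftrightarrow> ?n \<in> A"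
      unfolding f_image by (simp_all add: f_def)
    have dec: "nths (xs @ u # v # ys) B = nths xs B @ (if ?n \<in> B then [u] else []) @
        (if Suc ?n \<in> B then [v] else []) @ nths ys {j. Suc (Suc (j + ?n)) \<in> B}" for u v B
      by (simp add: nths_append nths_Cons)
    have "nths Q A = nths R (f ` A) \<or> comm_swap W (nths Q A) (nths R (f ` A))"
      unfolding *(1,2) dec x y n using comm_swapI[OF *(3)] by auto
    thus ?thesis using reduced_expression_comm_swap by auto
  qed
  ultimately show ?thesis by (rule word_isoI)
qed

lemma word_iso_comm_eq: "comm_eq Q R \<Longrightarrow> word_iso W S p Q R"
  by (induction rule: rtranclp_induct) (auto intro: word_iso_refl word_iso_trans word_iso_comm_swap)

section \<open>Sorting words by greedy choice\<close>

text \<open>The property defining \<open>sorting_positions\<close>, restricted to positions from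
  \<open>i\<close> on, so that the greedy scan can be treated by induction.\<close>

definition sorting_from :: "'a list \<Rightarrow> 'a \<Rightarrow> nat \<Rightarrow> nat list \<Rightarrow> bool" where
  "sorting_from cw w i ps \<longleftrightarrow> reduced_positions W S cw w ps \<and> (\<forall>j \<in> set ps. i \<le> j) \<and>
     (\<forall>qs. reduced_positions W S cw w qs \<and> (\<forall>j \<in> set qs. i \<le> j) \<longrightarrow>
        qs = ps \<or> (ps, qs) \<in> lexord less_than)"

lemma reduced_positions_Cons_iff:
  assumes "s = cw ! (i mod length cw)"
  shows "reduced_positions W S cw w (i # ps) \<longleftrightarrow>
    s \<in> S \<and> w \<in> carrier W \<and> len (s \<otimes> w) < len w \<and>
    (\<forall>j \<in> set ps. i < j) \<and> reduced_positions W S cw (s \<otimes> w) ps" (is "?L \<longleftrightarrow> ?R")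
proof
  let ?ws = "subword_at cw ps"
  have sub: "subword_at cw (i # ps) = s # ?ws" using assms by (simp add: subword_at_def)
  show ?R if ?L
  proof -
    have r: "reduced (s # ?ws)" "s \<otimes> wprod ?ws = w"
      using that sub by (auto simp: reduced_positions_def reduced_expression_iff)
    have c: "s \<in> S" "set ?ws \<subseteq> S" using reduced_head_descent[OF r(1)] by auto
    hence "s \<otimes> w = wprod ?ws" using r(2)[symmetric] by simp
    thus ?thesis using that r c reduced_ConsD[OF r(1)] reduced_head_descent[OF r(1)]
      by (auto simp: reduced_positions_def reduced_expression_iff)
  qed
  show ?L if ?R
  proof -
    have r: "reduced ?ws" "wprod ?ws = s \<otimes> w"
      using that by (auto simp: reduced_positions_def reduced_expression_iff)
    hence "s \<otimes> wprod ?ws = w" using that by simp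
    moreover from this have "reduced (s # ?ws)" using that r by (simp add: reduced_Cons_iff)
    ultimately show ?thesis
      using that sub by (auto simp: reduced_positions_def reduced_expression_iff)
  qed
qed

text \<open>A list starting at \<open>i\<close> precedes every list starting later, and the empty
  list is excluded because \<open>w\<close> has a descent.\<close>

lemma sorting_from_take:
  assumes s: "s = cw ! (i mod length cw)" "s \<in> S" and w: "w \<in> carrier W" "len (s \<otimes> w) < len w"
    and ps: "sorting_from cw (s \<otimes> w) (Suc i) ps"
  shows "sorting_from cw w i (i # ps)"
  unfolding sorting_from_def
proof (intro conjI allI impI)
  show "reduced_positions W S cw w (i # ps)"
    using ps s w by (auto simp: sorting_from_def reduced_positions_Cons_iff[OF s(1)])
  show "\<forall>j\<in>set (i # ps). i \<le> j" using ps by (auto simp: sorting_from_def)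
  fix qs assume qs: "reduced_positions W S cw w qs \<and> (\<forall>j\<in>set qs. i \<le> j)"
  show "qs = i # ps \<or> (i # ps, qs) \<in> lexord less_than"
  proof (cases qs)
    case Nil
    hence "w = \<one>" using qs by (simp add: reduced_positions_def reduced_expression_iff subword_at_def)
    thus ?thesis using w by simp
  next
    case (Cons q qs')
    show ?thesis
    proof (cases "q = i")
      case True
      hence "reduced_positions W S cw (s \<otimes> w) qs'" "\<forall>j\<in>set qs'. Suc i \<le> j"
        using qs Cons reduced_positions_Cons_iff[OF s(1)] by auto
      thus ?thesis using ps Cons True by (auto simp: sorting_from_def)
    next
      case False
      thus ?thesis using qs Cons by auto
    qed
  qed
qed

lemma sorting_from_skip:
  assumes s: "s = cw ! (i mod length cw)" "\<not> (s \<in> S \<and> len (s \<otimes> w) < len w)"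
    and ps: "sorting_from cw w (Suc i) ps"
  shows "sorting_from cw w i ps"
  unfolding sorting_from_def
proof (intro conjI allI impI)
  show "reduced_positions W S cw w ps" "\<forall>j\<in>set ps. i \<le> j"
    using ps by (auto simp: sorting_from_def)
  fix qs assume qs: "reduced_positions W S cw w qs \<and> (\<forall>j\<in>set qs. i \<le> j)"
  have "\<forall>j\<in>set qs. Suc i \<le> j"
  proof (cases qs)
    case (Cons q qs')
    hence "q \<noteq> i" using qs reduced_positions_Cons_iff[OF s(1)] s(2) by auto
    thus ?thesis using qs Cons by (auto simp: reduced_positions_def)
  qed simp
  thus "qs = ps \<or> (ps, qs) \<in> lexord less_than" using qs ps by (auto simp: sorting_from_def)
qed

text \<open>
  A letter of a fireable word \<open>Q\<close> that no longer occurs in \<open>Q\<close> is skipped from now on, whereas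
  the next letter of the periodic word that occurs in \<open>Q\<close> is a source and can be moved to the front.
\<close>

lemma ex_sorting_from:
  assumes "fireable (filter (\<lambda>x. x \<in> set Q) (rotate i cw)) Q" "reduced Q" "set Q \<subseteq> set cw"
  shows "\<exists>ps. sorting_from cw (wprod Q) i ps \<and> comm_eq Q (subword_at cw ps)"
  using assms
proof (induction "length Q" arbitrary: Q i rule: less_induct)
  case less
  let ?a = "\<lambda>i. cw ! (i mod length cw)"
  show ?case
  proof (cases "Q = []")
    case True
    have "qs = []" if "reduced_positions W S cw \<one> qs" for qs
    proof -
      have "length (subword_at cw qs) = 0"
        using that unfolding reduced_positions_def reduced_expression_iff reduced_def by (metis len_one)
      thus ?thesis by (simp add: subword_at_def)
    qed
    thus ?thesis using True
      by (intro exI[of _ "[]"])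
        (auto simp: sorting_from_def reduced_positions_def reduced_expression_iff subword_at_def)
  next
    case False
    have QS: "set Q \<subseteq> S" using less(3) reduced_subset by blast
    have cw: "cw \<noteq> []" using False less(4) by auto
    have rot: "rotate i cw = ?a i # tl (rotate i cw)" "rotate (Suc i) cw = tl (rotate i cw) @ [?a i]" for i
      using cw hd_rotate_conv_nth[OF cw, of i]
      by (metis hd_Cons_tl rotate_is_Nil_conv, metis rotate1_hd_tl rotate_Suc rotate_is_Nil_conv)
    have take: "\<exists>ps. sorting_from cw (wprod Q) i ps \<and> comm_eq Q (subword_at cw ps)"
      if ai: "?a i \<in> set Q" and fi: "fireable (filter (\<lambda>x. x \<in> set Q) (rotate i cw)) Q" for i
    proof -
      define s where "s = ?a i"
      define d where "d = tl (rotate i cw)"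
      have d: "rotate i cw = s # d" "rotate (Suc i) cw = d @ [s]" using rot[of i] by (auto simp: s_def d_def)
      have s: "s \<in> set Q" "s \<in> S" using ai QS by (auto simp: s_def)
      let ?c = "filter (\<lambda>x. x \<in> set Q) (rotate i cw)"
      have c: "?c = s # filter (\<lambda>x. x \<in> set Q) d" using d s by simp
      have "source s ?c" using source_split_iff[of s "[]"] c by simp
      then obtain R where R: "comm_eq Q (s # R)" "fireable ?c (s # R)"
        using fireable_source_first fi s(1) by blast
      have red: "reduced (s # R)" using comm_eq_reduced R(1) less(3) by blast
      have RQ: "set R \<subseteq> set Q" "length R < length Q" using comm_eq_props(1,2)[OF R(1)] by auto
      have "fire s ?c = filter (\<lambda>x. x \<in> set Q) (rotate (Suc i) cw)"
        using c d s by (simp add: fire_def)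
      hence "fireable (filter (\<lambda>x. x \<in> set Q) (rotate (Suc i) cw)) R" using R(2) by simp
      hence "fireable (filter (\<lambda>x. x \<in> set R) (filter (\<lambda>x. x \<in> set Q) (rotate (Suc i) cw))) R"
        by (rule fireable_filter) simp
      moreover have "filter (\<lambda>x. x \<in> set R) (filter (\<lambda>x. x \<in> set Q) (rotate (Suc i) cw))
          = filter (\<lambda>x. x \<in> set R) (rotate (Suc i) cw)"
        using RQ by (auto intro: filter_cong)
      ultimately have "fireable (filter (\<lambda>x. x \<in> set R) (rotate (Suc i) cw)) R" by simp
      then obtain ps where ps: "sorting_from cw (wprod R) (Suc i) ps" "comm_eq R (subword_at cw ps)"
        using less(1)[OF RQ(2)] reduced_ConsD[OF red] RQ(1) less(4) by blast
      have w: "wprod Q = s \<otimes> wprod R" using comm_eq_props(4)[OF R(1)] QS by simp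
      have RS: "set R \<subseteq> S" using RQ QS by auto
      have "sorting_from cw (wprod Q) i (i # ps)"
        using ps(1) red s RS w QS
        by (intro sorting_from_take[of s]) (auto simp: s_def[symmetric] reduced_Cons_iff)
      moreover have "comm_eq Q (subword_at cw (i # ps))"
        using rtranclp_trans[OF R(1) comm_eq_Cons[OF ps(2), of s]] by (simp add: subword_at_def s_def)
      ultimately show ?thesis by blast
    qed
    obtain m where m: "m < length cw" "cw ! m = hd Q"
      using False less(4) by (metis hd_in_set in_set_conv_nth subsetD)
    \<comment> \<open>A distance from \<open>i\<close> to an occurrence of \<open>hd Q\<close>,
      chosen so that the sum is \<open>m + length cw * i\<close>; its existence bounds the search
      for the next letter in \<open>Q\<close>.\<close>
    have "(i + (m + (length cw - 1) * i)) mod length cw = m"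
    proof -
      have "i + (m + (length cw - 1) * i) = m + length cw * i"
        using cw by (cases "length cw") (auto simp: algebra_simps)
      thus ?thesis using m by (metis mod_less mod_mult_self2)
    qed
    hence "?a (i + (m + (length cw - 1) * i)) \<in> set Q" using m False by simp
    then obtain k where "?a (i + k) \<in> set Q" by blast
    thus ?thesis using less(2)
    \<comment> \<open>The inner induction runs over the distance to a letter occurring in
      \<open>Q\<close>; letters skipped on the way are no descents of the product.\<close>
    proof (induction k arbitrary: i)
      case 0
      thus ?case using take[of i] by simp
    next
      case (Suc k)
      show ?case
      proof (cases "?a i \<in> set Q")
        case True
        thus ?thesis using take[of i] Suc.prems by simp
      next
        case False
        hence skip: "\<not> (?a i \<in> S \<and> len (?a i \<otimes> wprod Q) < len (wprod Q))"
          using descent_in_support QS by blast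
        have "filter (\<lambda>x. x \<in> set Q) (rotate (Suc i) cw) = filter (\<lambda>x. x \<in> set Q) (rotate i cw)"
          using rot[of i] False by (metis append_Nil2 filter.simps filter_append)
        then obtain ps where "sorting_from cw (wprod Q) (Suc i) ps" "comm_eq Q (subword_at cw ps)"
          using Suc.IH[of "Suc i"] Suc.prems by auto
        thus ?thesis using sorting_from_skip[OF refl skip] by blast
      qed
    qed
  qed
qed

end

section \<open>Rotation, and transitivity of source firing\<close>

context coxeter_system
begin

lemma comm_eq_sorting_word:
  assumes "set cw = S" "fireable cw Q" "reduced Q" "wprod Q = w"
  shows "comm_eq Q (sorting_word W S cw w)"
proof -
  have "fireable (filter (\<lambda>x. x \<in> set Q) (rotate 0 cw)) Q"
    using fireable_filter[of cw Q "set Q"] assms by simp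
  then obtain ps where ps: "sorting_from cw w 0 ps" "comm_eq Q (subword_at cw ps)"
    using ex_sorting_from[of Q 0 cw] assms reduced_subset by blast
  have "sorting_positions W S cw w = ps"
    unfolding sorting_positions_def
  proof (rule the_equality)
    show "reduced_positions W S cw w ps \<and>
        (\<forall>qs. reduced_positions W S cw w qs \<longrightarrow> qs = ps \<or> (ps, qs) \<in> lexord less_than)"
      using ps(1) by (simp add: sorting_from_def)
    fix qs assume qs: "reduced_positions W S cw w qs \<and>
        (\<forall>rs. reduced_positions W S cw w rs \<longrightarrow> rs = qs \<or> (qs, rs) \<in> lexord less_than)"
    show "qs = ps"
    proof (rule ccontr)
      assume "qs \<noteq> ps"
      hence "(ps, qs) \<in> lexord less_than" "(qs, ps) \<in> lexord less_than"
        using qs ps(1) by (auto simp: sorting_from_def)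
      thus False using lexord_asymmetric[of less_than ps qs] by (auto simp: asym_on_def intro: asymI)
    qed
  qed
  thus ?thesis using ps(2) by (simp add: sorting_word_def)
qed

section \<open>Left descents of products of distinct generators\<close>

text \<open>Both \<open>r\<close> and the first letter \<open>b\<close> are left descents of
  \<open>r b as = b as r\<close>. If they did not commute, a reduced word of this element would
  begin with \<open>r b r\<close>. Once they commute, \<open>b\<close> can be cancelled.\<close>

lemma commutes_with_letters:
  "\<lbrakk>distinct (r # as); set (r # as) \<subseteq> S; r \<otimes> wprod as = wprod as \<otimes> r; a \<in> set as\<rbrakk> \<Longrightarrow> a \<otimes> r = r \<otimes> a"
proof (induction as)
  case (Cons b as)
  have S: "r \<in> S" "b \<in> S" "set as \<subseteq> S" using Cons.prems by auto
  define w where "w = wprod (r # b # as)"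
  have w: "w \<in> carrier W" "w = wprod (b # as @ [r])"
    using S Cons.prems(3) by (simp_all add: w_def m_assoc)
  have red: "reduced (r # b # as)" "reduced (b # as @ [r])"
    using Cons.prems by (auto intro!: distinct_reduced)
  have d: "len (s \<otimes> w) < len w" if "s \<in> {r, b}" for s
    using that reduced_head_descent(3)[OF red(1)] reduced_head_descent(3)[OF red(2)] w w_def by auto
  have br: "b \<otimes> r = r \<otimes> b"
  proof (rule ccontr)
    assume nc: "b \<otimes> r \<noteq> r \<otimes> b"
    hence red3: "reduced [r, b, r]" using reduced_braid[of r b] S by metis
    have "len (inv (wprod [r, b, r]) \<otimes> w) + 3 = len w"
      using descents_reduced_prefix[of w "{r, b}" "[r, b, r]"] w(1) d red3 S by auto
    moreover obtain vs where vs: "reduced vs" "wprod vs = inv (wprod [r, b, r]) \<otimes> w"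
      using ex_reduced[of "inv (wprod [r, b, r]) \<otimes> w"] w S by auto
    ultimately have len: "length ([r, b, r] @ vs) = len w" by (simp add: reduced_def)
    have vS: "set vs \<subseteq> S" using vs reduced_subset by blast
    have "wprod ([r, b, r] @ vs) = wprod [r, b, r] \<otimes> wprod vs"
      using S vS by (intro word_prod_append) auto
    also have "\<dots> = w" using vs(2) S w by simp
    finally have eq: "wprod ([r, b, r] @ vs) = wprod (r # b # as)" by (simp add: w_def)
    \<comment> \<open>The word \<open>r b r vs\<close> must contain all letters of the
      repetition-free word \<open>r # b # as\<close> and has the same length, which its repeated
      \<open>r\<close> rules out.\<close>
    have "set (r # b # as) \<subseteq> set ([r, b, r] @ vs)"
      using reduced_support[OF red(1), of "[r, b, r] @ vs"] eq S vS by simp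
    hence "set (r # b # as) \<subseteq> set (b # r # vs)" by auto
    hence "card (set (r # b # as)) \<le> length (b # r # vs)"
      by (meson List.finite_set card_length card_mono le_trans)
    moreover have "card (set (r # b # as)) = len w"
      using Cons.prems(1) red(1) distinct_card[of "r # b # as"] by (simp add: reduced_def w_def)
    ultimately show False using len by simp
  qed
  have "b \<otimes> (r \<otimes> wprod as) = b \<otimes> (wprod as \<otimes> r)"
    using Cons.prems(3) br S by (simp flip: m_assoc)
  hence "r \<otimes> wprod as = wprod as \<otimes> r" using S by simp
  thus ?case using Cons br by auto
qed simp

text \<open>Exchange yields a prefix \<open>as\<close> and a letter \<open>x\<close> with
  \<open>r as = as x\<close>. By supports and distinctness \<open>x = r\<close>, so \<open>r\<close>
  commutes with the product of \<open>as\<close> and then with each of its letters.\<close>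

lemma left_descent_source:
  assumes "distinct e" "set e \<subseteq> S" "r \<in> S" "len (r \<otimes> wprod e) < len (wprod e)"
  shows "source r e"
proof -
  obtain as x bs where *: "e = as @ x # bs" "r = wprod as \<otimes> x \<otimes> inv (wprod as)"
    using left_exchange[OF assms(2) _ assms(4)] assms(3) gen_reflection by metis
  have S: "set as \<subseteq> S" "x \<in> S" using * assms by auto
  have sub: "set (rev as @ [r] @ as) \<subseteq> S" using S assms(3) by simp
  have "x = wprod (rev as @ [r] @ as)" using * S assms(3) by (simp add: wprod_rev m_assoc)
  hence "x \<in> set (rev as @ [r] @ as)" by (rule gen_in_support[OF S(2) sub])
  hence x: "x = r" using * assms(1) by auto
  hence "r \<otimes> wprod as = wprod as \<otimes> r" using *(2) S
    by (metis assms(3) gen_closed gen_word_closed inv_closed inv_solve_right m_closed word_prod_closed)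
  hence "\<forall>a \<in> set as. a \<otimes> r = r \<otimes> a"
    using commutes_with_letters[of r as] *(1) assms(1,2) x by auto
  thus ?thesis using source_split_iff[of r as bs] *(1) x assms(1) by auto
qed

end

section \<open>Rotation by the longest element\<close>

context finite_coxeter_system
begin

lemma len_conj_w0: "x \<in> carrier W \<Longrightarrow> len (w0 \<otimes> x \<otimes> w0) = len x"
  using len_mult_w0[of "w0 \<otimes> x"] w0_mult_len[of x] by simp

lemma fireable_rotate:
  assumes c: "distinct (s # b)" "set (s # b) = S"
    and Q: "fireable (s # b) Q" "reduced Q" "wprod Q = w0"
  obtains R where "comm_eq Q (s # R)" "fireable (b @ [s]) (R @ [w0 \<otimes> s \<otimes> w0])"
    "reduced (R @ [w0 \<otimes> s \<otimes> w0])" "wprod (R @ [w0 \<otimes> s \<otimes> w0]) = w0"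
proof -
  define r where "r = w0 \<otimes> s \<otimes> w0"
  have s: "s \<in> S" "set b \<subseteq> S" using c by auto
  have r: "r \<in> S" using w0_conj_gen s by (simp add: r_def)
  have QS: "set Q \<subseteq> S" using Q reduced_subset by blast
  have "s \<in> set Q" using descent_in_support[OF s(1) QS] Q(3) w0_descent[OF s(1)] by simp
  moreover have "source s (s # b)" using source_split_iff[of s "[]"] by simp
  ultimately obtain R where R: "comm_eq Q (s # R)" "fireable (s # b) (s # R)"
    using fireable_source_first Q(1) by blast
  have RS: "set R \<subseteq> S" using comm_eq_props(2)[OF R(1)] QS by auto
  have sR: "s \<otimes> wprod R = w0" using comm_eq_props(4)[OF R(1)] Q(3) QS by simp
  hence wR: "wprod R = s \<otimes> w0" using s RS by (metis gen_cancel gen_word_closed word_prod_closed)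
  define e where "e = fold fire (s # R) (s # b)"
  have e: "distinct e" "set e = S" using fireable_props[OF R(2) c(1)] c(2) by (auto simp: e_def)
  have conj: "wprod (s # b) \<otimes> w0 = w0 \<otimes> wprod e"
    using fireable_wprod[OF R(2) c(1) equalityD1[OF c(2)]] sR by (simp add: e_def)
  have "wprod e = w0 \<otimes> (w0 \<otimes> wprod e)"
    using equalityD1[OF e(2)] by (intro w0_cancel[symmetric] word_prod_closed gen_word_closed)
  also have "\<dots> = w0 \<otimes> wprod (s # b) \<otimes> w0" unfolding conj[symmetric] using s by (simp add: m_assoc)
  finally have we: "wprod e = w0 \<otimes> wprod (s # b) \<otimes> w0" .
  have "r \<otimes> wprod e = w0 \<otimes> wprod b \<otimes> w0" using s by (simp add: we r_def m_assoc)
  hence "len (r \<otimes> wprod e) = len (wprod b)" using s len_conj_w0 by simp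
  moreover have "len (wprod e) = len (wprod (s # b))" unfolding we using s len_conj_w0 by simp
  moreover have "reduced (s # b)" using c by (intro distinct_reduced) auto
  ultimately have "len (r \<otimes> wprod e) < len (wprod e)" by (simp add: reduced_Cons_iff)
  \<comment> \<open>Only the product \<open>w0 c w0\<close> of \<open>e\<close> is known, not the
    order of its letters; a left descent of the product is a source all the same.\<close>
  hence "source r e" using left_descent_source e r by simp
  moreover have "fire s (s # b) = b @ [s]" by (simp add: fire_def)
  ultimately have "fireable (b @ [s]) (R @ [r])"
    using R(2) by (simp add: fireable_append e_def)
  moreover have w: "wprod (R @ [r]) = w0" using RS r wR s by (simp add: r_def m_assoc)
  moreover have "reduced (R @ [r])"
    using comm_eq_props(1)[OF R(1)] Q RS r w by (simp add: reduced_def)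
  ultimately show ?thesis using that R(1) by (simp add: r_def)
qed

text \<open>The equations \<open>s ws = w0\<close> and \<open>ws (w0 s w0) = w0\<close> both say
  \<open>ws = s w0\<close>. So the cyclic shift taking the first position to the last preserves
  reduced expressions.\<close>

lemma word_iso_rotate:
  assumes s: "s \<in> S"
  shows "word_iso W S w0 (s # Q) (Q @ [w0 \<otimes> s \<otimes> w0])"
proof -
  let ?n = "length Q" and ?r = "w0 \<otimes> s \<otimes> w0"
  define f where "f i = (case i of 0 \<Rightarrow> ?n | Suc j \<Rightarrow> j)" for i
  have "bij_betw f {..<length (s # Q)} {..<length (Q @ [?r])}"
    by (rule bij_betw_byWitness[where f' = "\<lambda>j. if j = ?n then 0 else Suc j"])
      (auto simp: f_def split: nat.splits)
  moreover have "reduced_expression W S (nths (s # Q) A) w0 \<longleftrightarrow>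
      reduced_expression W S (nths (Q @ [?r]) (f ` A)) w0" if A: "A \<subseteq> {..<length (s # Q)}" for A
  proof -
    have "?n = f i \<longleftrightarrow> i = 0" if "i \<in> A" for i using that A by (cases i) (auto simp: f_def)
    hence fn: "?n \<in> f ` A \<longleftrightarrow> 0 \<in> A" unfolding image_iff by metis
    have "j = f i \<longleftrightarrow> i = Suc j" if "j < ?n" for i j using that by (cases i) (auto simp: f_def)
    hence "j \<in> f ` A \<longleftrightarrow> Suc j \<in> A" if "j < ?n" for j unfolding image_iff using that by metis
    hence fQ: "nths Q (f ` A) = nths Q {j. Suc j \<in> A}" by (intro nths_cong_set) auto
    have "reduced_expression W S (s # ws) w0 \<longleftrightarrow> reduced_expression W S (ws @ [?r]) w0" for ws
    proof (cases "set ws \<subseteq> S")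
      case True
      have "s \<otimes> wprod ws = w0 \<longleftrightarrow> wprod ws = s \<otimes> w0"
        using s True by (metis gen_cancel gen_closed gen_word_closed w0_closed word_prod_closed)
      moreover have "wprod ws \<otimes> ?r = w0 \<longleftrightarrow> wprod ws = s \<otimes> w0"
      proof
        assume "wprod ws \<otimes> ?r = w0"
        hence "wprod ws \<otimes> ?r \<otimes> ?r = w0 \<otimes> ?r" by simp
        thus "wprod ws = s \<otimes> w0" using s True by (simp add: m_assoc)
      qed (use s in \<open>simp add: m_assoc\<close>)
      ultimately have "wprod (s # ws) = w0 \<longleftrightarrow> wprod (ws @ [?r]) = w0"
        using True s w0_conj_gen[OF s] by simp
      thus ?thesis using True s w0_conj_gen[OF s] by (auto simp: reduced_expression_iff reduced_def)
    qed (auto simp: reduced_expression_iff reduced_def)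
    thus ?thesis using fn fQ by (simp add: nths_Cons nths_append)
  qed
  ultimately show ?thesis by (rule word_isoI)
qed

section \<open>The Coxeter graph of a finite system is a forest\<close>

text \<open>The second claim, that the latest letter is the only left descent, is the invariant that
  carries the induction. Letters are prepended, hence the reversed list.\<close>

lemma walk_reduced:
  fixes f :: "nat \<Rightarrow> 'a"
  assumes f: "\<And>i. f i \<in> S" "\<And>i. f i \<otimes> f (Suc i) \<noteq> f (Suc i) \<otimes> f i" "\<And>i. f (Suc (Suc i)) \<noteq> f i"
  shows "reduced (rev (map f [0..<n])) \<and>
    (\<forall>q \<in> S. len (q \<otimes> wprod (rev (map f [0..<n]))) < len (wprod (rev (map f [0..<n]))) \<longrightarrow>
       (\<exists>m. n = Suc m \<and> q = f m))"
proof (induction n rule: less_induct)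
  case (less n)
  let ?w = "\<lambda>n. wprod (rev (map f [0..<n]))"
  have wS: "set (rev (map f [0..<n])) \<subseteq> S" for n using f(1) by auto
  have w_closed: "?w n \<in> carrier W" for n using wS[of n] by (intro word_prod_closed gen_word_closed)
  have w_Suc: "?w (Suc n) = f n \<otimes> ?w n" for n by simp
  have w_Suc': "f n \<otimes> ?w (Suc n) = ?w n" for n unfolding w_Suc using f(1) w_closed by simp
  show ?case
  proof (cases n)
    case 0
    thus ?thesis by simp
  next
    case (Suc m)
    have IH: "reduced (rev (map f [0..<m]))"
      "\<And>q. \<lbrakk>q \<in> S; len (q \<otimes> ?w m) < len (?w m)\<rbrakk> \<Longrightarrow> \<exists>l. m = Suc l \<and> q = f l"
      using less[of m] Suc by auto
    have "\<not> len (f m \<otimes> ?w m) < len (?w m)"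
    proof
      assume "len (f m \<otimes> ?w m) < len (?w m)"
      then obtain l where "m = Suc l" "f m = f l" using IH(2)[of "f m"] f(1) by auto
      thus False using f(2)[of l] by simp
    qed
    hence lt: "len (?w m) < len (?w n)"
      using len_mult_reflection_neq[of "?w m" "f m"] f(1) w_closed Suc w_Suc by auto
    hence red: "reduced (rev (map f [0..<n]))"
      using IH(1) f(1) Suc by (simp add: reduced_Cons_iff)
    have "q = f m" if q: "q \<in> S" "len (q \<otimes> ?w n) < len (?w n)" for q
    proof (rule ccontr)
      assume ne: "q \<noteq> f m"
      have d: "len (x \<otimes> ?w n) < len (?w n)" if "x \<in> {q, f m}" for x
        using that q(2) lt w_Suc'[of m] Suc by auto
      have pre: "len (inv (wprod xs) \<otimes> ?w n) + length xs = len (?w n)"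
        if "reduced xs" "set xs \<subseteq> {q, f m}" for xs
        using descents_reduced_prefix[OF w_closed _ d that] q(1) f(1) by auto
      \<comment> \<open>With two descents, \<open>f m q\<close> begins a reduced word, so
        \<open>q\<close> is a descent one step earlier and equals the letter before
        \<open>f m\<close>. These do not commute, so even \<open>f m q f m\<close> is such a
        beginning; then \<open>f m\<close> is a descent two steps earlier and the walk
        backtracks.\<close>
      have "reduced [f m, q]" using ne q f(1) by (intro distinct_reduced) auto
      from pre[OF this] have "len (q \<otimes> ?w m) + 2 = len (?w n)"
        using q(1) f(1) w_closed w_Suc'[of m] Suc by (simp add: inv_mult_group m_assoc)
      moreover have "len (?w n) \<le> len (?w m) + 1"
        using Suc w_Suc len_mult_le[of "f m" "?w m"] f(1) w_closed by simp
      ultimately have qm: "len (q \<otimes> ?w m) < len (?w m)" by simp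
      then obtain l where l: "m = Suc l" "q = f l" using IH(2) q(1) by blast
      have "reduced [f m, q, f m]" using reduced_braid[of "f m" q] f q(1) l by metis
      from pre[OF this] have "len (f m \<otimes> ?w l) + 3 = len (?w n)"
        using q(1) f(1) w_closed w_Suc'[of m] w_Suc'[of l] Suc l
        by (simp add: inv_mult_group m_assoc)
      moreover have "len (?w n) \<le> len (?w l) + 2"
      proof -
        have "len (?w j) = j" if "reduced (rev (map f [0..<j]))" for j
          using that unfolding reduced_def by (metis diff_zero length_map length_rev length_upt)
        from this[OF red] this[OF conjunct1[OF less[of l]]] show ?thesis using Suc l by simp
      qed
      ultimately have "len (f m \<otimes> ?w l) < len (?w l)" by simp
      then obtain k where "l = Suc k" "f m = f k" using less[of l] Suc l f(1) by auto
      thus False using f(3)[of k] l by simp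
    qed
    thus ?thesis using red Suc by blast
  qed
qed

text \<open>If every vertex had two neighbours, a walk without backtracking would be an infinite reduced word.\<close>

lemma ex_leaf:
  assumes "J \<subseteq> S" "J \<noteq> {}"
  shows "\<exists>r \<in> J. \<forall>x \<in> J. \<forall>y \<in> J. x \<otimes> r \<noteq> r \<otimes> x \<and> y \<otimes> r \<noteq> r \<otimes> y \<longrightarrow> x = y"
proof (rule ccontr)
  assume no_leaf: "\<not> ?thesis"
  have two: "\<exists>y. y \<in> J \<and> y \<otimes> r \<noteq> r \<otimes> y \<and> y \<noteq> x" if r: "r \<in> J" for r x
  proof -
    obtain y z where "y \<in> J" "z \<in> J" "y \<otimes> r \<noteq> r \<otimes> y" "z \<otimes> r \<noteq> r \<otimes> z" "y \<noteq> z"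
      using no_leaf r by blast
    thus ?thesis by (cases "y = x") auto
  qed
  obtain r0 where r0: "r0 \<in> J" using assms by blast
  \<comment> \<open>The walk is chosen edge by edge, so that avoiding backtracking relates only
    consecutive choices.\<close>
  let ?P = "\<lambda>(n::nat) (a, b). a \<in> J \<and> b \<in> J \<and> a \<otimes> b \<noteq> b \<otimes> a"
  let ?Q = "\<lambda>(n::nat) (a, b) (a', b'). a' = b \<and> b' \<noteq> a"
  have "\<exists>g. \<forall>n. ?P n (g n) \<and> ?Q n (g n) (g (Suc n))"
  proof (rule dependent_nat_choice)
    obtain y where "y \<in> J" "y \<otimes> r0 \<noteq> r0 \<otimes> y" using two[OF r0] by blast
    thus "\<exists>ab. ?P 0 ab" using r0 by (intro exI[of _ "(y, r0)"]) auto
    fix ab :: "'a \<times> 'a" and n :: nat assume ab: "?P n ab"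
    obtain a b where "ab = (a, b)" by fastforce
    moreover from this obtain y where "y \<in> J" "y \<otimes> b \<noteq> b \<otimes> y" "y \<noteq> a" using two[of b a] ab by auto
    ultimately show "\<exists>ab'. ?P (Suc n) ab' \<and> ?Q n ab ab'" using ab by (intro exI[of _ "(b, y)"]) auto
  qed
  then obtain g where gn: "\<forall>n. ?P n (g n) \<and> ?Q n (g n) (g (Suc n))" by (rule exE)
  have g: "?P n (g n)" "?Q n (g n) (g (Suc n))" for n
    using spec[OF gn, of n] by (rule conjunct1, rule conjunct2)
  define f where "f n = fst (g n)" for n
  have snd_g: "snd (g n) = f (Suc n)" for n using g(2)[of n] by (auto simp: f_def split: prod.splits)
  have "f n \<in> S" for n using g(1)[of n] assms by (auto simp: f_def split: prod.splits)
  moreover have "f n \<otimes> f (Suc n) \<noteq> f (Suc n) \<otimes> f n" for n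
    using g(1)[of n] snd_g[of n] by (auto simp: f_def split: prod.splits)
  moreover have "f (Suc (Suc n)) \<noteq> f n" for n
    using g(2)[of n] snd_g[of "Suc n"] by (auto simp: f_def split: prod.splits)
  ultimately have red: "reduced (rev (map f [0..<Suc (len w0)]))" using walk_reduced by blast
  hence "len (wprod (rev (map f [0..<Suc (len w0)]))) = Suc (len w0)"
    unfolding reduced_def by (metis diff_zero length_map length_rev length_upt)
  moreover have "wprod (rev (map f [0..<Suc (len w0)])) \<in> carrier W"
    using reduced_subset[OF red] by (intro word_prod_closed gen_word_closed)
  ultimately show False using len_le_w0 by fastforce
qed

section \<open>Equivalence of orientations under source firing\<close>

definition flip_move :: "'a list \<Rightarrow> 'a list \<Rightarrow> bool" where
  "flip_move c d \<longleftrightarrow> comm_swap W c d \<or> (\<exists>s b. c = s # b \<and> d = b @ [s])"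

abbreviation flip_eq :: "'a list \<Rightarrow> 'a list \<Rightarrow> bool" where "flip_eq \<equiv> equivclp flip_move"

lemma flip_move_props: "flip_move c d \<Longrightarrow> set c = set d \<and> (distinct c \<longleftrightarrow> distinct d)"
  unfolding flip_move_def using comm_swap_props by auto

lemma flip_eq_props: "flip_eq c d \<Longrightarrow> set c = set d \<and> (distinct c \<longleftrightarrow> distinct d)"
  by (induction rule: equivclp_induct) (auto dest: flip_move_props)

lemma comm_eq_imp_flip_eq: "comm_eq c d \<Longrightarrow> flip_eq c d"
  by (induction rule: rtranclp_induct) (auto intro: equivclp_into_equivclp simp: flip_move_def)

lemma flip_move_imp_flip_eq: "flip_move c d \<Longrightarrow> flip_eq c d"
  by (rule r_into_equivclp)

text \<open>The leaf has at most one neighbour. If this is not in \<open>ys\<close>, then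
  \<open>r\<close> commutes to the end; otherwise it commutes to the front and is fired.\<close>

lemma leaf_to_end:
  assumes leaf: "\<forall>x \<in> J. \<forall>y \<in> J. x \<otimes> r \<noteq> r \<otimes> x \<and> y \<otimes> r \<noteq> r \<otimes> y \<longrightarrow> x = y"
    and J: "set xs \<subseteq> J" "set ys \<subseteq> J" "distinct (xs @ ys)"
  shows "flip_eq (xs @ r # ys) (xs @ ys @ [r])"
proof (cases "\<forall>y \<in> set ys. y \<otimes> r = r \<otimes> y")
  case True
  hence "comm_eq (ys @ [r]) (r # ys)" using comm_eq_move[of ys r "[]"] by simp
  hence "comm_eq (r # ys) (ys @ [r])" by (rule comm_eq_sym)
  thus ?thesis using comm_eq_append[of "r # ys" "ys @ [r]" xs "[]"] comm_eq_imp_flip_eq by simp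
next
  case False
  then obtain y where y: "y \<in> set ys" "y \<otimes> r \<noteq> r \<otimes> y" by blast
  have "x \<otimes> r = r \<otimes> x" if "x \<in> set xs" for x
    using leaf J y that by (metis disjoint_iff distinct_append subsetD)
  hence "flip_eq (xs @ r # ys) (r # xs @ ys)" using comm_eq_move comm_eq_imp_flip_eq by blast
  moreover have "flip_eq (r # xs @ ys) (xs @ ys @ [r])"
    by (rule flip_move_imp_flip_eq) (simp add: flip_move_def)
  ultimately show ?thesis by (rule equivclp_trans)
qed

text \<open>Induction by removing a leaf \<open>r\<close> of the graph on the letters; moves between
  the smaller lists are lifted to lists ending in \<open>r\<close>.\<close>

lemma flip_eq_same_set:
  "\<lbrakk>distinct c; distinct d; set c = set d; set c \<subseteq> S\<rbrakk> \<Longrightarrow> flip_eq c d"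
proof (induction "length c" arbitrary: c d rule: less_induct)
  case less
  show ?case
  proof (cases "c = []")
    case True
    thus ?thesis using less(4) by simp
  next
    case False
    obtain r where r: "r \<in> set c"
      and leaf: "\<forall>x \<in> set c. \<forall>y \<in> set c. x \<otimes> r \<noteq> r \<otimes> x \<and> y \<otimes> r \<noteq> r \<otimes> y \<longrightarrow> x = y"
      using ex_leaf[of "set c"] False less(5) by auto
    obtain xs ys where c: "c = xs @ r # ys" using r by (meson split_list)
    obtain us vs where d: "d = us @ r # vs" using r less(4) by (metis split_list)
    have "flip_eq (xs @ ys) (us @ vs)"
      using less(2-5) c d by (intro less(1)) auto
    hence "flip_eq ((xs @ ys) @ [r]) ((us @ vs) @ [r])"
    proof (induction rule: equivclp_induct)
      case base
      show ?case by simp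
    next
      case (step y z)
      \<comment> \<open>Firing the first letter puts it behind \<open>r\<close>;
        \<open>leaf_to_end\<close> then restores \<open>r\<close> to the last place.\<close>
      have lift: "flip_eq (a @ [r]) (b @ [r])"
        if ab: "flip_move a b" "set a \<subseteq> set c" "distinct a" for a b
      proof (cases "comm_swap W a b")
        case True
        thus ?thesis using comm_swap_append[OF True, of "[]" "[r]"]
          by (intro flip_move_imp_flip_eq) (simp add: flip_move_def)
      next
        case False
        then obtain s a' where s: "a = s # a'" "b = a' @ [s]" using ab(1) by (auto simp: flip_move_def)
        have "flip_eq (a @ [r]) (a' @ r # [s])"
          using s by (intro flip_move_imp_flip_eq) (simp add: flip_move_def)
        moreover have "flip_eq (a' @ r # [s]) (a' @ [s] @ [r])"
          using ab s by (intro leaf_to_end[OF leaf]) auto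
        ultimately show ?thesis using s by (simp add: equivclp_trans)
      qed
      have y: "set y = set (xs @ ys)" "distinct y" and z: "set z = set (xs @ ys)" "distinct z"
        using flip_eq_props[OF step(1)] step(2) flip_move_props less(2) c by auto
      have "flip_eq (y @ [r]) (z @ [r])"
        using step(2) lift[of y z] lift[of z y] y z c by (auto intro: equivclp_sym)
      thus ?case using step(3) by (meson equivclp_trans)
    qed
    moreover have "flip_eq c (xs @ ys @ [r])"
      using leaf_to_end[OF leaf, of xs ys] less(2) c by auto
    moreover have "flip_eq d (us @ vs @ [r])"
      using leaf_to_end[OF leaf, of us vs] less(3,4) d by auto
    ultimately show ?thesis by (metis append.assoc equivclp_sym equivclp_trans)
  qed
qed

section \<open>Isomorphisms between multi-cluster complexes\<close>

abbreviation multi_cluster_word :: "nat \<Rightarrow> 'a list \<Rightarrow> 'a list" where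
  "multi_cluster_word k c \<equiv> concat (replicate k c) @ sorting_word W S c w0"

lemma comm_eq_concat_replicate: "comm_eq c d \<Longrightarrow> comm_eq (concat (replicate k c)) (concat (replicate k d))"
  by (induction k) (auto intro: comm_eq_append_cong)

lemma concat_replicate_rotate:
  "concat (replicate k (s # b)) @ [s] = s # concat (replicate k (b @ [s]))"
  by (induction k) auto

lemma word_iso_flip_move:
  assumes c: "distinct c" "set c = S" and cd: "flip_move c d"
  shows "word_iso W S w0 (multi_cluster_word k c) (multi_cluster_word k d)"
proof -
  have d: "distinct d" "set d = S" using flip_move_props[OF cd] c by auto
  obtain Q where Q: "fireable c Q" "reduced Q" "wprod Q = w0" using ex_fireable_w0[OF c] by blast
  have sc: "comm_eq (sorting_word W S c w0) Q"
    using comm_eq_sorting_word[OF c(2) Q] by (rule comm_eq_sym)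
  show ?thesis
  proof (cases "comm_swap W c d")
    case True
    hence "fireable d Q" using fireable_comm_eq[of c d] Q(1) by blast
    hence "comm_eq Q (sorting_word W S d w0)" using comm_eq_sorting_word d Q by blast
    hence "comm_eq (multi_cluster_word k c) (multi_cluster_word k d)"
      using True comm_eq_concat_replicate[of c d k] sc
      by (intro comm_eq_append_cong) (auto intro: rtranclp_trans)
    thus ?thesis by (rule word_iso_comm_eq)
  next
    case False
    then obtain s b where sb: "c = s # b" "d = b @ [s]" using cd by (auto simp: flip_move_def)
    have s: "s \<in> S" using sb c by auto
    obtain R where R: "comm_eq Q (s # R)" "fireable d (R @ [w0 \<otimes> s \<otimes> w0])"
      "reduced (R @ [w0 \<otimes> s \<otimes> w0])" "wprod (R @ [w0 \<otimes> s \<otimes> w0]) = w0"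
      using fireable_rotate[of s b Q] c Q sb by metis
    have "comm_eq (multi_cluster_word k c) (concat (replicate k c) @ s # R)"
      using rtranclp_trans[OF sc R(1)] by (intro comm_eq_append_cong) auto
    hence "word_iso W S w0 (multi_cluster_word k c) (concat (replicate k c) @ s # R)"
      by (rule word_iso_comm_eq)
    \<comment> \<open>From \<open>c = s b\<close> and \<open>d = b s\<close> one has
      \<open>c^k s = s d^k\<close>. Rotating this leading \<open>s\<close> to the end completes
      \<open>R\<close> to a sorting word for \<open>d\<close> up to commutations.\<close>
    moreover have "concat (replicate k c) @ s # R = s # (concat (replicate k d) @ R)"
      using concat_replicate_rotate[of k s b] sb by (metis append.assoc append_Cons append_Nil)
    moreover have "word_iso W S w0 (s # (concat (replicate k d) @ R))
        ((concat (replicate k d) @ R) @ [w0 \<otimes> s \<otimes> w0])"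
      by (rule word_iso_rotate[OF s])
    moreover have "word_iso W S w0 ((concat (replicate k d) @ R) @ [w0 \<otimes> s \<otimes> w0]) (multi_cluster_word k d)"
      unfolding append.assoc using comm_eq_sorting_word[OF d(2) R(2-4)]
      by (intro word_iso_comm_eq comm_eq_append_cong) auto
    ultimately show ?thesis by (metis word_iso_trans)
  qed
qed

lemma word_iso_flip_eq:
  assumes "flip_eq c d" "distinct c" "set c = S"
  shows "word_iso W S w0 (multi_cluster_word k c) (multi_cluster_word k d)"
  using assms(1)
proof (induction rule: equivclp_induct)
  case base
  show ?case by (rule word_iso_refl)
next
  case (step y z)
  have y: "distinct y" "set y = S" using flip_eq_props[OF step(1)] assms by auto
  have z: "distinct z" "set z = S" using step(2) y flip_move_props by auto
  have "word_iso W S w0 (multi_cluster_word k y) (multi_cluster_word k z)"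
    using step(2)
  proof
    assume "flip_move z y"
    from word_iso_flip_move[OF z this] show ?thesis by (rule word_iso_sym)
  qed (rule word_iso_flip_move[OF y])
  thus ?case by (rule word_iso_trans[OF step(3)])
qed

end

theorem theorem2p6:
  fixes W :: "('a, 'b) monoid_scheme" and S :: "'a set" and k :: nat
    and c c' :: 'a and cw cw' :: "'a list"
  assumes "coxeter_system W S"
    and "finite (carrier W)"
    and "coxeter_element W S c"
    and "coxeter_element W S c'"
    and "reduced_expression W S cw c"
    and "reduced_expression W S cw' c'"
  shows "complex_isomorphic (multi_cluster_complex W S k cw) (multi_cluster_complex W S k cw')"
proof -
  interpret finite_coxeter_system W S
    using assms(1,2) by (simp add: finite_coxeter_system_def finite_coxeter_system_axioms_def)
  have cw: "distinct cw" "set cw = S" "distinct cw'" "set cw' = S"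
    using reduced_Coxeter_word assms(3-6) by blast+
  hence "flip_eq cw cw'" by (intro flip_eq_same_set) auto
  thus ?thesis
    unfolding multi_cluster_complex_def
    by (intro word_iso_complex_isomorphic word_iso_flip_eq[OF _ cw(1,2)])
qed

end
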